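(* Let $d \geq 2$ be an integer and let $K$ be a convex body in $\mathbb{R}^d$ with $\lambda_d(K)=1$. Then there are constants $C_1=C_1(d)>0$, $C_2=C_2(d)>0$, and $n_0=n_0(d)$ such that for every set $S$ of $n \geq n_0$ points chosen uniformly and independently at random from $K$, the expected number $E^K_d$ of islands in $S$ satisfies \[2^{C_1 \cdot n^{(d-1)/(d+1)}} \leq E^K_d \leq 2^{C_2 \cdot n^{(d-1)/(d+1)}}.\]
   Context: A convex body in $\mathbb{R}^d$ is a compact convex set with nonempty interior; $\lambda_d$ denotes $d$-dimensional Lebesgue measure. For a finite point set $S\subseteq\mathbb{R}^d$, a subset $I\subseteq S$ is an island in $S$ if $\mathrm{conv}(I)\cap S = I$ (an island of size $k$ is a $k$-island, for any $k$). *)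

theory Defs
  imports "HOL-Probability.Probability"
begin

definition convex_body :: "'a::euclidean_space set \<Rightarrow> bool" where
  "convex_body K \<longleftrightarrow> compact K \<and> convex K \<and> interior K \<noteq> {}"

definition is_island :: "'a::real_vector set \<Rightarrow> 'a set \<Rightarrow> bool" where
  "is_island S I \<longleftrightarrow> I \<subseteq> S \<and> convex hull I \<inter> S = I"

text \<open>Islands of every size are counted, including the empty one.\<close>

definition num_islands :: "'a::real_vector set \<Rightarrow> nat" where
  "num_islands S = card {I. is_island S I}"

text \<open>A sample is a family of \<open>n\<close> independent points, each uniformly distributed in \<open>K\<close>;
  the random point set is the range of this family, which has \<open>n\<close> elements almost surely
  when \<open>K\<close> is a convex body in a space of positive dimension.\<close>

definition uniform_sample :: "nat \<Rightarrow> 'a::euclidean_space set \<Rightarrow> (nat \<Rightarrow> 'a) measure" where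
  "uniform_sample n K = PiM {..<n} (\<lambda>_. uniform_measure lborel K)"

definition expected_islands :: "nat \<Rightarrow> 'a::euclidean_space set \<Rightarrow> real" where
  "expected_islands n K = (LINT x | uniform_sample n K. real (num_islands (x ` {..<n})))"

end

theory Submission
  imports Defs
begin

text \<open>
  An affine change of coordinates puts \<open>K\<close> between a box and the cube \<open>[-1, 1]^d\<close>, with volumes
  controlled by \<open>d\<close> alone; let \<open>M\<close> be about \<open>n^(1/(d+1))\<close>.

  Lower bound: a paraboloid inside the box has about \<open>M^(d-1)\<close> disjoint caps of volume about \<open>1/n\<close>.
  Cutting off any set of caps leaves a convex set, so the number of islands is at least two to the
  number of caps that are hit, and the expected number of these is proportional to \<open>n^((d-1)/(d+1))\<close>.

  Upper bound: up to a shell of volume \<open>O(1/M^2)\<close>, every convex subset of the cube is one of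
  \<open>2^(O(M^(d-1)))\<close> sets (a bracketing form of Bronshtein's entropy bound), and an island is
  determined by this approximation and its points in the shell, of which \<open>O(n/M^2)\<close> are expected.
  To bracket a convex set, it is written as the intersection of \<open>2 d\<close> epigraphs of Lipschitz convex
  functions, and each function is recorded on a grid of mesh \<open>1/M\<close> up to \<open>1/M^2\<close>. On a cell it is
  affine up to a second difference; these sum to \<open>O(M^(d-1) / M^2)\<close> by telescoping, and the same
  telescoping along lines bounds the number of possible records.
\<close>

section \<open>Volumes of linear preimages\<close>

text \<open>The exponent balances two costs: the logarithm of the number of brackets, of order
  \<open>M^(d-1)\<close>, and the expected number of shell points, of order \<open>n / M^2\<close>.
  They agree when \<open>M^(d+1)\<close> is about \<open>n\<close>; at the same scale a cap with
  base of side about \<open>1/M\<close> and depth about \<open>1/M^2\<close> has volume about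
  \<open>1/n\<close>. The obstacle is a logarithm: recording every grid value up to
  \<open>1/M^2\<close> separately would cost \<open>log M\<close> bits per point. Along a line a
  convex function has nearly monotone increments, so its record is essentially a subset of an
  interval of length \<open>O(M)\<close>, that is, \<open>O(M)\<close> bits for \<open>O(M)\<close>
  points. Likewise the error on a single cell can be as large as order \<open>1/M\<close>; only the
  sum over all cells is small. To keep both estimates free of boundary effects, the functions are
  infimal convolutions with an \<open>l1\<close> norm, defined and Lipschitz on the whole space.
  Passing from the number of shell points to the expected power of two takes no concentration
  inequality: by independence the expectation is at most \<open>(1 + v)^n <= exp (v * n)\<close> for
  a shell of volume \<open>v\<close>.\<close>

lemma emeasure_lborel_bounded:
  fixes S :: "'a::euclidean_space set"
  assumes "bounded S"
  shows "emeasure lborel S = ennreal (measure lborel S)"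
  using emeasure_bounded_finite[OF assms] by (intro emeasure_eq_ennreal_measure) auto

text \<open>The scaling factor comes from the uniqueness of Haar measure, that is, from Fubini applied to
  \<open>(x, y) \<mapsto> 1\<^sub>S (g y) 1\<^sub>Q (x - g y)\<close>.\<close>

lemma lborel_linear_vimage:
  fixes f g :: "'a::euclidean_space \<Rightarrow> 'a"
  assumes "linear f" "linear g" and gf: "\<And>x. g (f x) = x"
  obtains c :: real where "c \<ge> 0"
    and "\<And>S. S \<in> sets borel \<Longrightarrow> emeasure lborel (g -` S) = ennreal c * emeasure lborel S"
proof -
  have [measurable]: "f \<in> borel_measurable borel" "g \<in> borel_measurable borel"
    using assms by (auto intro!: borel_measurable_continuous_onI linear_continuous_on
      simp: linear_conv_bounded_linear)
  have fg: "f (g x) = x" for x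
    using assms linear_injective_left_inverse
    by (metis linear_inverse_left o_apply id_apply eq_id_iff)
  have transl: "(\<integral>\<^sup>+ x. h (x + t) \<partial>lborel) = (\<integral>\<^sup>+ x. h x \<partial>lborel)"
    if [measurable]: "h \<in> borel_measurable borel" for h :: "'a \<Rightarrow> ennreal" and t
    by (subst (2) lborel_distr_plus[of t, symmetric]) (simp add: nn_integral_distr add.commute)
  define Q :: "'a set" where "Q = ball 0 1"
  have [measurable]: "Q \<in> sets borel" by (simp add: Q_def)
  define q where "q = measure lborel Q"
  have q: "emeasure lborel Q = ennreal q" "q > 0"
    using content_ball_pos[of 1 "0::'a"] by (auto simp: q_def Q_def emeasure_lborel_bounded)
  define N where "N = emeasure lborel ((\<lambda>y. - g y) -` Q)"
  have "(\<lambda>y. - g y) -` Q \<subseteq> f ` Q"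
  proof
    fix y assume "y \<in> (\<lambda>y. - g y) -` Q"
    then have "g y \<in> Q" by (simp add: Q_def)
    then show "y \<in> f ` Q" using fg by (metis image_eqI)
  qed
  moreover have "bounded (f ` Q)"
    using assms(1) by (intro bounded_linear_image) (auto simp: Q_def linear_conv_bounded_linear)
  ultimately have "bounded ((\<lambda>y. - g y) -` Q)" by (rule bounded_subset[rotated])
  then have N: "N = ennreal (enn2real N)"
    unfolding N_def by (simp add: emeasure_lborel_bounded)
  have key: "emeasure lborel (g -` S) * emeasure lborel Q = N * emeasure lborel S"
    if [measurable]: "S \<in> sets borel" for S
  proof -
    have "emeasure lborel (g -` S) * emeasure lborel Q
        = (\<integral>\<^sup>+ y. indicator S (g y) \<partial>lborel) * emeasure lborel Q"
    proof -
      have [measurable]: "g -` S \<in> sets borel"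
        using measurable_sets_borel[of g borel S] by simp
      show ?thesis
        by (simp add: indicator_vimage[symmetric] flip: nn_integral_indicator)
    qed
    also have "\<dots> = (\<integral>\<^sup>+ y. (\<integral>\<^sup>+ x. indicator S (g y) * indicator Q x \<partial>lborel) \<partial>lborel)"
      by (simp add: nn_integral_cmult nn_integral_multc)
    also have "\<dots> = (\<integral>\<^sup>+ y. (\<integral>\<^sup>+ x. indicator S (g y) * indicator Q (x + (- g y)) \<partial>lborel) \<partial>lborel)"
      by (subst transl) simp_all
    also have "\<dots> = (\<integral>\<^sup>+ x. (\<integral>\<^sup>+ y. indicator S (g y) * indicator Q (x + (- g y)) \<partial>lborel) \<partial>lborel)"
      by (rule lborel_pair.Fubini') measurable
    \<comment> \<open>Shifting \<open>y\<close> by \<open>f x\<close> replaces \<open>g y\<close> by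
      \<open>x + g y\<close>. The argument of \<open>Q\<close> becomes \<open>- g y\<close>, free of
      \<open>x\<close>, so the integral over \<open>x\<close> sees only \<open>S\<close>.\<close>
    also have "\<dots> = (\<integral>\<^sup>+ x. (\<integral>\<^sup>+ y. indicator S (g (y + f x)) * indicator Q (x + (- g (y + f x))) \<partial>lborel) \<partial>lborel)"
      by (subst transl[of "\<lambda>y. indicator S (g y) * indicator Q (_ + (- g y))"]) simp_all
    also have "\<dots> = (\<integral>\<^sup>+ x. (\<integral>\<^sup>+ y. indicator S (x + g y) * indicator Q (- g y) \<partial>lborel) \<partial>lborel)"
      using assms(2) by (simp add: linear_add gf add.commute)
    also have "\<dots> = (\<integral>\<^sup>+ y. (\<integral>\<^sup>+ x. indicator S (x + g y) * indicator Q (- g y) \<partial>lborel) \<partial>lborel)"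
      by (rule lborel_pair.Fubini'[symmetric]) measurable
    also have "\<dots> = (\<integral>\<^sup>+ y. indicator Q (- g y) * (\<integral>\<^sup>+ x. indicator S (x + g y) \<partial>lborel) \<partial>lborel)"
      by (simp add: nn_integral_cmult mult.commute)
    also have "\<dots> = (\<integral>\<^sup>+ y. indicator Q (- g y) * emeasure lborel S \<partial>lborel)"
      by (subst transl) simp_all
    also have "\<dots> = N * emeasure lborel S"
    proof -
      have [measurable]: "(\<lambda>y. - g y) -` Q \<in> sets borel"
        using measurable_sets_borel[of "\<lambda>y. - g y" borel Q] by simp
      show ?thesis
        unfolding N_def
        by (simp add: nn_integral_multc indicator_vimage[of "\<lambda>y. - g y", symmetric]
            flip: nn_integral_indicator)
    qed
    finally show ?thesis .
  qed
  show ?thesis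
  proof (rule that)
    show "enn2real N / q \<ge> 0" using q by simp
    fix S :: "'a set" assume "S \<in> sets borel"
    from key[OF this] have "emeasure lborel (g -` S) * ennreal q * ennreal (1 / q)
      = ennreal (enn2real N) * emeasure lborel S * ennreal (1 / q)"
      using q N by simp
    then show "emeasure lborel (g -` S) = ennreal (enn2real N / q) * emeasure lborel S"
      using q by (simp add: mult.assoc ennreal_mult[symmetric] mult.commute[of "emeasure lborel S"])
        (simp add: mult.assoc[symmetric] ennreal_mult[symmetric])
  qed
qed

text \<open>Applying the involution twice shows that its scaling factor satisfies
  \<open>c * c = 1\<close>, and \<open>c\<close> is nonnegative; no determinant has to be
  computed.\<close>

lemma lborel_linear_involution:
  fixes g :: "'a::euclidean_space \<Rightarrow> 'a"
  assumes "linear g" and gg: "\<And>x. g (g x) = x" and S: "S \<in> sets borel"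
  shows "emeasure lborel (g -` S) = emeasure lborel S"
proof -
  obtain c where c: "c \<ge> 0"
    "\<And>S. S \<in> sets borel \<Longrightarrow> emeasure lborel (g -` S) = ennreal c * emeasure lborel S"
    using lborel_linear_vimage[OF assms(1) assms(1) gg] by blast
  let ?Q = "ball 0 1 :: 'a set"
  have "g \<in> borel_measurable borel"
    using assms by (auto intro!: borel_measurable_continuous_onI linear_continuous_on
      simp: linear_conv_bounded_linear)
  then have "g -` ?Q \<in> sets borel" using measurable_sets_borel[of g borel ?Q] by simp
  then have "emeasure lborel (g -` (g -` ?Q)) = ennreal (c * c) * emeasure lborel ?Q"
    using c by (simp add: ennreal_mult mult.assoc)
  moreover have "g -` (g -` ?Q) = ?Q" using gg by auto
  ultimately have "ennreal 1 * ennreal (measure lborel ?Q) = ennreal (c * c) * ennreal (measure lborel ?Q)"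
    by (simp add: emeasure_lborel_bounded)
  then have "c * c = 1"
    using c content_ball_pos[of 1 "0::'a"]
    by (subst (asm) (1 2) ennreal_mult[symmetric]) auto
  then have "c = 1" using c(1) by (metis abs_of_nonneg mult_1 power2_eq_square real_sqrt_abs real_sqrt_one)
  then show ?thesis using c(2)[OF S] by simp
qed

section \<open>Volume of a sheared box\<close>

lemma slab_eq_vimage_cbox:
  fixes v l u :: "real^'n"
  shows "{x. (\<forall>i. i \<noteq> k \<longrightarrow> l $ i \<le> x $ i \<and> x $ i \<le> u $ i) \<and> l $ k \<le> v \<bullet> x - x $ k \<and> v \<bullet> x - x $ k \<le> u $ k}
    = (\<lambda>x. \<chi> i. if i = k then v \<bullet> x - x $ k else x $ i) -` cbox l u"
  by (auto simp: mem_box_cart) (metis+)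

text \<open>The sign in \<open>v \<bullet> x - x $ k\<close> makes the shear that replaces
  coordinate \<open>k\<close> its own inverse: \<open>v $ k = 0\<close>, so the shear leaves
  \<open>v \<bullet> x\<close> unchanged. Both the slabs inside the caps and the pieces of the shell
  have this form.\<close>

lemma emeasure_slab:
  fixes v l u :: "real^'n"
  assumes "v $ k = 0" and "\<And>i. l $ i \<le> u $ i"
  shows "emeasure lborel {x. (\<forall>i. i \<noteq> k \<longrightarrow> l $ i \<le> x $ i \<and> x $ i \<le> u $ i) \<and>
      l $ k \<le> v \<bullet> x - x $ k \<and> v \<bullet> x - x $ k \<le> u $ k} = ennreal (\<Prod>i\<in>UNIV. u $ i - l $ i)" (is "emeasure _ ?S = _")
proof -
  let ?R = "\<lambda>x::real^'n. \<chi> i. if i = k then v \<bullet> x - x $ k else x $ i"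
  have lin: "linear ?R"
    by (rule linearI) (auto simp: vec_eq_iff inner_add_right algebra_simps)
  have vR: "v \<bullet> ?R x = v \<bullet> x" for x
    unfolding inner_vec_def by (rule sum.cong) (use assms(1) in auto)
  have "?R (?R x) = x" for x
    unfolding vec_eq_iff using vR[of x] by simp
  then have "emeasure lborel (?R -` cbox l u) = emeasure lborel (cbox l u)"
    by (intro lborel_linear_involution lin) auto
  also have "\<dots> = ennreal (measure lborel (cbox l u))"
    by (simp add: emeasure_lborel_bounded)
  also have "measure lborel (cbox l u) = (\<Prod>i\<in>UNIV. u $ i - l $ i)"
    using assms(2) by (subst content_cbox_cart) (auto simp: interval_ne_empty_cart)
  finally show ?thesis unfolding slab_eq_vimage_cbox .
qed

lemma closed_slab:
  fixes v l u :: "real^'n"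
  shows "closed {x. (\<forall>i. i \<noteq> k \<longrightarrow> l $ i \<le> x $ i \<and> x $ i \<le> u $ i) \<and>
      l $ k \<le> v \<bullet> x - x $ k \<and> v \<bullet> x - x $ k \<le> u $ k}"
  by (intro closed_Collect_conj closed_Collect_all closed_Collect_imp open_Collect_const
      closed_Collect_le continuous_intros)

section \<open>Affine normalisation of a convex body\<close>

lemma continuous_on_det:
  "continuous_on S (\<lambda>A::real^'n^'n. det A)"
  unfolding det_def by (intro continuous_intros)

lemma compact_matrices_with_columns_in:
  fixes K :: "(real^'m) set"
  assumes "compact K"
  shows "compact {A::real^'n^'m. \<forall>j. column j A \<in> K}"
proof (subst compact_eq_bounded_closed, intro conjI)
  obtain B where B: "\<And>x. x \<in> K \<Longrightarrow> norm x \<le> B"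
    using compact_imp_bounded[OF assms] unfolding bounded_iff by auto
  have "norm A \<le> (\<Sum>i\<in>(UNIV::'m set). \<Sum>j\<in>(UNIV::'n set). B)" if A: "\<forall>j. column j A \<in> K" for A :: "real^'n^'m"
  proof -
    have "norm A \<le> (\<Sum>i\<in>UNIV. norm (A $ i))" 
      unfolding norm_vec_def[of A] by (rule L2_set_le_sum) simp
    also have "\<dots> \<le> (\<Sum>i\<in>UNIV. \<Sum>j\<in>UNIV. \<bar>A $ i $ j\<bar>)"
      by (intro sum_mono norm_le_l1_cart)
    also have "\<dots> \<le> (\<Sum>i\<in>(UNIV::'m set). \<Sum>j\<in>(UNIV::'n set). B)"
    proof (intro sum_mono)
      fix i j
      have "\<bar>A $ i $ j\<bar> = \<bar>column j A $ i\<bar>" by (simp add: column_def)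
      also have "\<dots> \<le> norm (column j A)" by (rule component_le_norm_cart)
      also have "\<dots> \<le> B" using A B by blast
      finally show "\<bar>A $ i $ j\<bar> \<le> B" .
    qed
    finally show ?thesis .
  qed
  then show "bounded {A::real^'n^'m. \<forall>j. column j A \<in> K}"
    unfolding bounded_iff by blast
  have "closed ((\<lambda>A::real^'n^'m. column j A) -` K)" for j
    unfolding column_def using assms
    by (intro closed_vimage compact_imp_closed continuous_intros)
  then have "closed (\<Inter>j. (\<lambda>A::real^'n^'m. column j A) -` K)" by blast
  also have "(\<Inter>j. (\<lambda>A::real^'n^'m. column j A) -` K) = {A. \<forall>j. column j A \<in> K}" by auto
  finally show "closed {A::real^'n^'m. \<forall>j. column j A \<in> K}" .
qed

text \<open>The columns of \<open>A\<close> maximise the determinant among vectors from \<open>K - x0\<close>, so by Cramer's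
  rule the coordinates of all points of \<open>K - x0\<close> are bounded by 1.\<close>

lemma convex_body_affine_position:
  fixes K :: "(real^'n) set"
  assumes "convex_body K"
  obtains x0 :: "real^'n" and A :: "real^'n^'n"
  where "invertible A"
    and "\<And>y. (\<forall>i. 0 \<le> y $ i \<and> y $ i \<le> 1 / real CARD('n)) \<Longrightarrow> x0 + A *v y \<in> K"
    and "\<And>y i. x0 + A *v y \<in> K \<Longrightarrow> \<bar>y $ i\<bar> \<le> 1"
proof -
  have K: "compact K" "convex K" "interior K \<noteq> {}" using assms by (auto simp: convex_body_def)
  then obtain x0 e where e: "e > 0" "ball x0 e \<subseteq> K" by (meson all_not_in_conv mem_interior)
  then have x0: "x0 \<in> K" by auto
  define K0 where "K0 = (\<lambda>x. x - x0) ` K"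
  have "compact K0" unfolding K0_def
    by (intro compact_continuous_image K continuous_intros)
  have "convex K0" unfolding K0_def using K(2) by (rule convex_translation_subtract)
  define U where "U = {A::real^'n^'n. \<forall>j. column j A \<in> K0}"
  \<comment> \<open>A small multiple of the identity has its columns in \<open>K0\<close>, so the
    maximal determinant is not zero.\<close>
  define A0 :: "real^'n^'n" where "A0 = (\<chi> i j. if i = j then e / 2 else 0)"
  have "column j A0 \<in> K0" for j
  proof -
    have "column j A0 = (e / 2) *\<^sub>R axis j 1"
      by (auto simp: column_def A0_def axis_def vec_eq_iff)
    moreover have "x0 + (e / 2) *\<^sub>R axis j 1 \<in> ball x0 e"
      using e by (simp add: dist_norm)
    ultimately show ?thesis unfolding K0_def using e
      by (intro image_eqI[of _ _ "x0 + (e / 2) *\<^sub>R axis j 1"]) auto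
  qed
  then have "A0 \<in> U" by (simp add: U_def)
  have "compact U" unfolding U_def by (rule compact_matrices_with_columns_in) fact
  obtain A where "A \<in> U" and A: "\<And>B. B \<in> U \<Longrightarrow> \<bar>det B\<bar> \<le> \<bar>det A\<bar>"
    using continuous_attains_sup[OF \<open>compact U\<close>, of "\<lambda>B. \<bar>det B\<bar>"] \<open>A0 \<in> U\<close> continuous_on_det
    by (auto intro: continuous_on_rabs)
  have "det A0 = (\<Prod>i\<in>(UNIV::'n set). e / 2)"
    unfolding A0_def by (subst det_diagonal) auto
  then have "det A0 \<noteq> 0" using e by simp
  with A[OF \<open>A0 \<in> U\<close>] have "det A \<noteq> 0" by auto
  show ?thesis
  proof (rule that[of A x0])
    show "invertible A" using \<open>det A \<noteq> 0\<close> by (simp add: invertible_det_nz)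
  next
    fix y :: "real^'n" assume y: "\<forall>i. 0 \<le> y $ i \<and> y $ i \<le> 1 / real CARD('n)"
    have "sum (($) y) UNIV \<le> (\<Sum>i\<in>(UNIV::'n set). 1 / real CARD('n))"
      using y by (intro sum_mono) auto
    then have s: "sum (($) y) UNIV \<le> 1" by simp
    \<comment> \<open>The index \<open>None\<close> carries the origin, which belongs to
      \<open>K0\<close>, with the weight left over by the coordinates of \<open>y\<close>.\<close>
    let ?a = "\<lambda>j::'n option. case j of None \<Rightarrow> 1 - sum (($) y) UNIV | Some j \<Rightarrow> y $ j"
    let ?x = "\<lambda>j::'n option. case j of None \<Rightarrow> 0 | Some j \<Rightarrow> column j A"
    have U: "(UNIV :: 'n option set) = insert None (Some ` UNIV)"
      by (auto simp: UNIV_option_conv)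
    have "0 \<in> K0" using x0 by (auto simp: K0_def)
    have "(\<Sum>j\<in>UNIV. ?a j *\<^sub>R ?x j) \<in> K0"
    proof (rule convex_sum)
      show "sum ?a UNIV = 1" unfolding U by (simp add: sum.reindex)
    qed (use \<open>convex K0\<close> \<open>0 \<in> K0\<close> \<open>A \<in> U\<close> s y in \<open>auto simp: U_def split: option.splits\<close>)
    also have "(\<Sum>j\<in>UNIV. ?a j *\<^sub>R ?x j) = A *v y"
      unfolding U by (simp add: sum.reindex matrix_mult_sum scalar_mult_eq_scaleR)
    finally show "x0 + A *v y \<in> K" by (auto simp: K0_def)
  next
    fix y :: "real^'n" and k assume "x0 + A *v y \<in> K"
    then have y: "A *v y \<in> K0" unfolding K0_def by (metis add_diff_cancel_left' image_eqI)
    let ?B = "\<chi> i j. if j = k then (A *v y) $ i else A $ i $ j"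
    have "column j ?B = (if j = k then A *v y else column j A)" for j
      by (auto simp: column_def vec_eq_iff)
    then have "?B \<in> U" using \<open>A \<in> U\<close> y by (simp add: U_def)
    from A[OF this] have "\<bar>y $ k\<bar> * \<bar>det A\<bar> \<le> 1 * \<bar>det A\<bar>"
      unfolding cramer_lemma by (simp add: abs_mult)
    then show "\<bar>y $ k\<bar> \<le> 1" using \<open>det A \<noteq> 0\<close> by simp
  qed
qed

text \<open>The bounds on \<open>c\<close> compare the unit volume of \<open>K\<close> with the
  preimages of the inner box \<open>[0, 1/d]^d\<close> and of the outer cube
  \<open>[-1, 1]^d\<close>. They involve the dimension only, which is why the final constants do not
  depend on \<open>K\<close>.\<close>

lemma convex_body_coordinates:
  fixes K :: "(real^'n) set"
  assumes "convex_body K" "measure lborel K = 1"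
  obtains g :: "real^'n \<Rightarrow> real^'n" and c :: real
  where "continuous_on UNIV g" "\<And>S. convex S \<Longrightarrow> convex (g -` S)" "\<And>S. convex S \<Longrightarrow> convex (g ` S)"
    and "\<And>S. S \<in> sets borel \<Longrightarrow> emeasure lborel (g -` S) = ennreal c * emeasure lborel S"
    and "\<And>x. (\<forall>i. 0 \<le> g x $ i \<and> g x $ i \<le> 1 / real CARD('n)) \<Longrightarrow> x \<in> K"
    and "\<And>x i. x \<in> K \<Longrightarrow> \<bar>g x $ i\<bar> \<le> 1"
    and "inj g"
    and "(1 / 2) ^ CARD('n) \<le> c" "c \<le> real CARD('n) ^ CARD('n)"
proof -
  obtain x0 :: "real^'n" and A :: "real^'n^'n" where A: "invertible A"
    and inner: "\<And>y. (\<forall>i. 0 \<le> y $ i \<and> y $ i \<le> 1 / real CARD('n)) \<Longrightarrow> x0 + A *v y \<in> K"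
    and outer: "\<And>y i. x0 + A *v y \<in> K \<Longrightarrow> \<bar>y $ i\<bar> \<le> 1"
    using convex_body_affine_position[OF assms(1)] by metis
  obtain B where AB: "A ** B = mat 1" "B ** A = mat 1" using A by (auto simp: invertible_def)
  obtain c where c: "c \<ge> 0"
    "\<And>S. S \<in> sets borel \<Longrightarrow> emeasure lborel ((\<lambda>x. B *v x) -` S) = ennreal c * emeasure lborel S"
    by (rule lborel_linear_vimage[of "\<lambda>x. A *v x" "\<lambda>x. B *v x"])
      (auto simp: matrix_vector_mul_assoc AB)
  define g where "g = (\<lambda>x. B *v (x - x0))"
  have cont: "continuous_on UNIV g" unfolding g_def
    by (intro continuous_on_compose2[OF matrix_vector_mult_linear_continuous_on] continuous_intros) auto
  have Tg: "x0 + A *v (g x) = x" for x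
    by (simp add: g_def matrix_vector_mul_assoc AB)
  have vim: "g -` S = (+) x0 ` ((\<lambda>x. B *v x) -` S)" for S
  proof
    show "g -` S \<subseteq> (+) x0 ` ((\<lambda>x. B *v x) -` S)"
      by (rule subsetI, rule_tac x = "x - x0" in image_eqI) (simp_all add: g_def)
  qed (auto simp: g_def)
  have em: "emeasure lborel (g -` S) = ennreal c * emeasure lborel S" if S: "S \<in> sets borel" for S
  proof -
    have g: "g \<in> borel_measurable borel" by (rule borel_measurable_continuous_onI[OF cont])
    have "emeasure lborel (g -` S) = emeasure (distr lborel borel ((+) x0)) (g -` S)"
      by (simp add: lborel_distr_plus)
    also have "\<dots> = emeasure lborel ((\<lambda>x. B *v x) -` S)"
      using measurable_sets_borel[OF g, of S] S
      by (subst emeasure_distr) (auto simp: g_def vimage_def)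
    finally show ?thesis using c(2)[OF S] by simp
  qed
  have K1: "emeasure lborel K = 1"
    using assms by (simp add: convex_body_def compact_imp_bounded emeasure_lborel_bounded)
  have [measurable]: "K \<in> sets borel" using assms by (simp add: convex_body_def borel_compact)
  have vim_meas: "g -` S \<in> sets borel" if "S \<in> sets borel" for S
    using measurable_sets_borel[OF borel_measurable_continuous_onI[OF cont] that] by simp
  let ?d = "CARD('n)"
  let ?I = "cbox 0 (\<chi> i. 1 / real ?d) :: (real^'n) set" and ?O = "cbox (\<chi> i. -1) (\<chi> i. 1) :: (real^'n) set"
  have box: "emeasure lborel (cbox a b) = ennreal (\<Prod>i\<in>UNIV. b $ i - a $ i)"
    if "\<And>i. a $ i \<le> b $ i" for a b :: "real^'n"
    using that
    by (subst content_cbox_cart[symmetric]) (auto simp: interval_ne_empty_cart emeasure_lborel_bounded)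
  have "emeasure lborel (g -` ?I) \<le> emeasure lborel K"
    by (intro emeasure_mono) (use inner Tg in \<open>force simp: mem_box_cart\<close>, simp)
  then have 1: "c * (1 / real ?d) ^ ?d \<le> 1"
    using c(1) by (simp add: em K1 box ennreal_mult[symmetric] del: ennreal_1 flip: ennreal_1)
  have "emeasure lborel K \<le> emeasure lborel (g -` ?O)"
    by (intro emeasure_mono) (use outer Tg vim_meas[of ?O] in \<open>fastforce simp: mem_box_cart abs_le_iff\<close>)+
  then have 2: "1 \<le> c * 2 ^ ?d"
    using c(1) by (simp add: em K1 box ennreal_mult[symmetric] del: ennreal_1 flip: ennreal_1)
  show ?thesis
  proof (rule that[OF cont _ _ em])
    show "convex (g -` S)" if "convex S" for S
    proof -
      have "convex ((\<lambda>x. B *v x) -` S)"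
        using that by (intro convex_linear_vimage) auto
      then show ?thesis unfolding vim by (rule convex_translation)
    qed
    show "convex (g ` S)" if "convex S" for S
    proof -
      have "g ` S = (\<lambda>x. B *v x) ` ((\<lambda>x. x - x0) ` S)" by (auto simp: g_def image_image)
      then show ?thesis using that by (auto intro!: convex_linear_image convex_translation_subtract)
    qed
    show "x \<in> K" if "\<forall>i. 0 \<le> g x $ i \<and> g x $ i \<le> 1 / real ?d" for x
      using inner[OF that] Tg by simp
    show "\<bar>g x $ i\<bar> \<le> 1" if "x \<in> K" for x i using outer[of "g x" i] that Tg by simp
    show "inj g" by (metis Tg injI)
    show "(1 / 2) ^ ?d \<le> c" using 2 by (simp add: field_simps power_one_over)
    show "c \<le> real ?d ^ ?d" using 1 by (simp add: field_simps power_one_over)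
  qed
qed

section \<open>Counting islands of a random sample\<close>

text \<open>Counting index sets makes the range of summation independent of the sample. Coinciding
  points cause no overcounting: if \<open>x i = x j\<close> and \<open>i \<in> A\<close>, the
  condition forces \<open>j \<in> A\<close>.\<close>

lemma num_islands_image:
  "num_islands (x ` {..<n})
    = card {A. A \<subseteq> {..<n} \<and> (\<forall>j<n. x j \<in> convex hull (x ` A) \<longrightarrow> j \<in> A)}"
proof -
  let ?P = "{A. A \<subseteq> {..<n} \<and> (\<forall>j<n. x j \<in> convex hull (x ` A) \<longrightarrow> j \<in> A)}"
  let ?Q = "{I. is_island (x ` {..<n}) I}"
  have "bij_betw ((`) x) ?P ?Q"
  proof (rule bij_betw_byWitness[where f' = "\<lambda>I. {i. i < n \<and> x i \<in> I}"])
    show "\<forall>A\<in>?P. {i. i < n \<and> x i \<in> x ` A} = A"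
      by (auto intro: hull_inc)
    show img: "\<forall>I\<in>?Q. x ` {i. i < n \<and> x i \<in> I} = I"
      by (auto simp: is_island_def)
    show "(`) x ` ?P \<subseteq> ?Q"
      by (auto simp: is_island_def intro: hull_inc)
    show "(\<lambda>I. {i. i < n \<and> x i \<in> I}) ` ?Q \<subseteq> ?P"
    proof clarify
      fix I assume I: "is_island (x ` {..<n}) I"
      then have "x ` {i. i < n \<and> x i \<in> I} = I" using img by blast
      with I show "{i. i < n \<and> x i \<in> I} \<subseteq> {..<n} \<and>
          (\<forall>j<n. x j \<in> convex hull (x ` {i. i < n \<and> x i \<in> I}) \<longrightarrow> j \<in> {i. i < n \<and> x i \<in> I})"
        by (auto simp: is_island_def)
    qed
  qed
  from bij_betw_same_card[OF this] show ?thesis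
    unfolding num_islands_def by simp
qed

text \<open>Strict separation from a finite set is an open condition on the normal, so a normal can
  be taken from a dense set. For countable \<open>D\<close> the event becomes a countable union,
  which yields measurability of the island count.\<close>

lemma not_in_convex_hull_iff_separated:
  fixes z :: "'a::euclidean_space"
  assumes D: "\<And>U :: 'a set. open U \<Longrightarrow> U \<noteq> {} \<Longrightarrow> \<exists>u\<in>D. u \<in> U" and "finite F"
  shows "z \<notin> convex hull F \<longleftrightarrow> (\<exists>u\<in>D. \<forall>y\<in>F. u \<bullet> z < u \<bullet> y)"
proof
  assume z: "z \<notin> convex hull F"
  have "closed (convex hull F)" using \<open>finite F\<close>
    by (simp add: compact_imp_closed finite_imp_compact_convex_hull)
  then obtain a b where "a \<bullet> z < b" "\<forall>y\<in>convex hull F. a \<bullet> y > b"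
    using separating_hyperplane_closed_point[OF convex_convex_hull _ z] by auto
  then have "a \<in> (\<Inter>y\<in>F. {u. u \<bullet> z < u \<bullet> y})"
    using hull_inc[of _ F convex] by fastforce
  moreover have "open (\<Inter>y\<in>F. {u. u \<bullet> z < u \<bullet> y})"
    using \<open>finite F\<close> by (intro open_INT ballI open_Collect_less continuous_intros)
  ultimately obtain u where "u \<in> D" "u \<in> (\<Inter>y\<in>F. {u. u \<bullet> z < u \<bullet> y})"
    using D[of "\<Inter>y\<in>F. {u. u \<bullet> z < u \<bullet> y}"] by auto
  then show "\<exists>u\<in>D. \<forall>y\<in>F. u \<bullet> z < u \<bullet> y" by auto
next
  assume "\<exists>u\<in>D. \<forall>y\<in>F. u \<bullet> z < u \<bullet> y"
  then obtain u where "F \<subseteq> {y. u \<bullet> z < u \<bullet> y}" by auto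
  then have "convex hull F \<subseteq> {y. u \<bullet> z < u \<bullet> y}"
    by (rule hull_minimal) (rule convex_halfspace_gt)
  then show "z \<notin> convex hull F" by auto
qed

lemma measurable_num_islands:
  fixes M :: "nat \<Rightarrow> 'a::euclidean_space measure"
  assumes M: "\<And>i. sets (M i) = sets borel"
  shows "(\<lambda>x. real (num_islands (x ` {..<n}))) \<in> borel_measurable (PiM {..<n} M)"
proof -
  obtain D :: "'a set" where D: "countable D"
    "\<And>U. open U \<Longrightarrow> U \<noteq> {} \<Longrightarrow> \<exists>u\<in>D. u \<in> U"
    by (erule countable_dense_setE)
  let ?P = "\<lambda>A x. \<forall>j\<in>{..<n} - A. \<exists>u\<in>D. \<forall>i\<in>A. u \<bullet> x j < u \<bullet> x i"
  have comp: "(\<lambda>x. x i) \<in> borel_measurable (PiM {..<n} M)" if "i < n" for i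
    using measurable_component_singleton[of i "{..<n}" M] that M by (simp cong: measurable_cong_sets)
  have eq: "real (num_islands (x ` {..<n})) = (\<Sum>A\<in>Pow {..<n}. if ?P A x then 1 else 0)" for x :: "nat \<Rightarrow> 'a"
  proof -
    have "{A. A \<subseteq> {..<n} \<and> (\<forall>j<n. x j \<in> convex hull (x ` A) \<longrightarrow> j \<in> A)}
      = {A \<in> Pow {..<n}. ?P A x}"
    proof (rule Collect_cong, unfold Pow_iff, rule conj_cong[OF refl])
      fix A assume "A \<subseteq> {..<n}"
      then have "finite (x ` A)" by (auto intro: finite_subset)
      then have "x j \<notin> convex hull (x ` A) \<longleftrightarrow> (\<exists>u\<in>D. \<forall>i\<in>A. u \<bullet> x j < u \<bullet> x i)" for j
        using not_in_convex_hull_iff_separated[OF D(2), of "x ` A"] by simp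
      then show "(\<forall>j<n. x j \<in> convex hull (x ` A) \<longrightarrow> j \<in> A) = ?P A x" by blast
    qed
    then show ?thesis
      unfolding num_islands_image
      by (simp add: sum.If_cases Int_def)
  qed
  have "(\<lambda>x. if ?P A x then 1 else 0 :: real) \<in> borel_measurable (PiM {..<n} M)" if A: "A \<in> Pow {..<n}" for A
  proof (rule measurable_If)
    have "{x \<in> space (PiM {..<n} M). u \<bullet> x j < u \<bullet> x i} \<in> sets (PiM {..<n} M)" if "i < n" "j < n" for u i j
      using comp that by (intro borel_measurable_less borel_measurable_inner) auto
    then have "{x \<in> space (PiM {..<n} M). \<forall>i\<in>A. u \<bullet> x j < u \<bullet> x i} \<in> sets (PiM {..<n} M)" if "j < n" for u j
      using that A finite_subset[of A "{..<n}"] by (intro sets.sets_Collect_finite_All) auto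
    then have "{x \<in> space (PiM {..<n} M). \<exists>u\<in>D. \<forall>i\<in>A. u \<bullet> x j < u \<bullet> x i} \<in> sets (PiM {..<n} M)" if "j < n" for j
      using that D(1) by (intro sets.sets_Collect_countable_Ex') auto
    then show "{x \<in> space (PiM {..<n} M). ?P A x} \<in> sets (PiM {..<n} M)"
      by (intro sets.sets_Collect_countable_All') (auto intro: countable_finite)
  qed auto
  then show ?thesis unfolding eq by (intro borel_measurable_sum)
qed

lemma num_islands_le: "num_islands (x ` {..<n}) \<le> 2 ^ n"
proof -
  have "num_islands (x ` {..<n}) \<le> card (Pow {..<n})"
    unfolding num_islands_image by (rule card_mono) auto
  then show ?thesis by (simp add: card_Pow)
qed

section \<open>Integrals over a uniform sample\<close>

context
  fixes K :: "'a::euclidean_space set"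
  assumes K: "convex_body K" "measure lborel K = 1"
begin

lemma prob_space_uniform: "prob_space (uniform_measure lborel K)"
proof (rule prob_space_uniform_measure)
  have "emeasure lborel K = 1"
    using K by (simp add: convex_body_def compact_imp_bounded emeasure_lborel_bounded)
  then show "emeasure lborel K \<noteq> 0" "emeasure lborel K \<noteq> \<infinity>" by auto
qed

lemma prob_space_uniform_sample: "prob_space (uniform_sample n K)"
  unfolding uniform_sample_def by (intro prob_space_PiM prob_space_uniform)

lemma measure_uniform:
  assumes "D \<in> sets borel"
  shows "measure (uniform_measure lborel K) D = measure lborel (K \<inter> D)"
proof -
  have "emeasure lborel K = 1"
    using K by (simp add: convex_body_def compact_imp_bounded emeasure_lborel_bounded)
  then show ?thesis using assms K by (subst measure_uniform_measure) auto
qed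

lemma integrable_num_islands:
  "integrable (uniform_sample n K) (\<lambda>x. real (num_islands (x ` {..<n})))"
proof -
  interpret prob_space "uniform_sample n K" by (rule prob_space_uniform_sample)
  show ?thesis
    by (rule integrable_const_bound[of _ "2 ^ n"])
      (auto simp: num_islands_le uniform_sample_def intro!: measurable_num_islands)
qed

text \<open>Two values of \<open>a\<close> matter. For \<open>a = -1\<close> the product indicates
  that no sample point lies in \<open>D\<close>; for \<open>a = 1\<close> it is 2 to the number of
  sample indices falling in \<open>D\<close>.\<close>

lemma prod_sample:
  assumes D: "D \<in> sets borel"
  shows "integrable (uniform_sample n K) (\<lambda>x. \<Prod>i<n. 1 + a * indicat_real D (x i))"
    and "(LINT x | uniform_sample n K. (\<Prod>i<n. 1 + a * indicat_real D (x i)))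
      = (1 + a * measure lborel (K \<inter> D)) ^ n"
proof -
  interpret prob_space "uniform_measure lborel K" by (rule prob_space_uniform)
  interpret product_sigma_finite "\<lambda>_::nat. uniform_measure lborel K" ..
  have int: "integrable (uniform_measure lborel K) (\<lambda>y. 1 + a * indicat_real D y)"
    using D by (intro Bochner_Integration.integrable_add integrable_mult_right) (auto simp: less_top[symmetric])
  show "integrable (uniform_sample n K) (\<lambda>x. \<Prod>i<n. 1 + a * indicat_real D (x i))"
    unfolding uniform_sample_def using int by (intro product_integrable_prod) auto
  have "(LINT x | uniform_sample n K. (\<Prod>i<n. 1 + a * indicat_real D (x i)))
      = (\<Prod>i<n. LINT y | uniform_measure lborel K. 1 + a * indicat_real D y)"
    unfolding uniform_sample_def using int by (intro product_integral_prod) auto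
  also have "(LINT y | uniform_measure lborel K. 1 + a * indicat_real D y) = 1 + a * measure lborel (K \<inter> D)"
    using D prob_space by (subst Bochner_Integration.integral_add) (auto simp: measure_uniform less_top[symmetric])
  finally show "(LINT x | uniform_sample n K. (\<Prod>i<n. 1 + a * indicat_real D (x i)))
      = (1 + a * measure lborel (K \<inter> D)) ^ n" by simp
qed

end

section \<open>Caps of a paraboloid\<close>

text \<open>Different sets of hit caps leave different islands: a point of \<open>S\<close> in a hit
  cap lies in \<open>P\<close> and in no other cap, so its presence reveals whether that cap was
  removed.\<close>

lemma num_islands_ge_caps:
  assumes "finite S" "finite Z" and disj: "disjoint_family_on c Z"
    and sub: "\<And>z. z \<in> Z \<Longrightarrow> c z \<subseteq> P"
    and conv: "\<And>T. T \<subseteq> Z \<Longrightarrow> convex (P - \<Union>(c ` T))"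
  shows "2 ^ card {z \<in> Z. c z \<inter> S \<noteq> {}} \<le> num_islands S"
proof -
  let ?Z = "{z \<in> Z. c z \<inter> S \<noteq> {}}" and ?h = "\<lambda>T. S \<inter> (P - \<Union>(c ` T))"
  have "inj_on ?h (Pow ?Z)"
  proof (rule inj_onI)
    have *: "T \<subseteq> T'" if T: "T \<in> Pow ?Z" "T' \<in> Pow ?Z" "?h T = ?h T'" for T T'
    proof
      fix z assume z: "z \<in> T"
      with T obtain s where s: "s \<in> S" "s \<in> c z" by blast
      have "z \<in> Z" using z T by blast
      then have "s \<notin> ?h T" "s \<in> P" using s z sub by auto
      then obtain z' where z': "z' \<in> T'" "s \<in> c z'" using s T(3) by auto
      then have "z' \<in> Z" using T by blast
      with disj \<open>z \<in> Z\<close> s z' have "z = z'"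
        unfolding disjoint_family_on_def by (metis IntI empty_iff)
      then show "z \<in> T'" using z' by simp
    qed
    show "T = T'" if "T \<in> Pow ?Z" "T' \<in> Pow ?Z" "?h T = ?h T'" for T T'
      using *[OF that] *[OF that(2,1) that(3)[symmetric]] by blast
  qed
  moreover have "?h ` Pow ?Z \<subseteq> {I. is_island S I}"
  proof clarify
    fix T assume "T \<subseteq> ?Z"
    then have "convex (P - \<Union>(c ` T))" using conv by blast
    then have "convex hull (?h T) \<subseteq> P - \<Union>(c ` T)" by (intro hull_minimal) auto
    then show "is_island S (?h T)" unfolding is_island_def using hull_subset[of "?h T" convex] by auto
  qed
  moreover have "finite {I. is_island S I}"
    by (rule finite_subset[of _ "Pow S"]) (use \<open>finite S\<close> in \<open>auto simp: is_island_def\<close>)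
  ultimately have "card (Pow ?Z) \<le> num_islands S"
    unfolding num_islands_def by (rule card_inj_on_le)
  then show ?thesis using \<open>finite Z\<close> by (simp add: card_Pow)
qed

text \<open>A cap of volume \<open>m\<close> is missed with probability \<open>(1 - m) ^ n\<close>,
  at most \<open>exp (- m * n)\<close>. Hits of different caps are dependent, but linearity of
  expectation gives the mean number of hits, and convexity of \<open>2 powr\<close> carries it into
  the exponent.\<close>

lemma expected_islands_ge_caps:
  fixes K :: "'a::euclidean_space set"
  assumes K: "convex_body K" "measure lborel K = 1"
    and "finite Z" and disj: "disjoint_family_on c Z"
    and sub: "\<And>z. z \<in> Z \<Longrightarrow> c z \<subseteq> P"
    and conv: "\<And>T. T \<subseteq> Z \<Longrightarrow> convex (P - \<Union>(c ` T))"
    and meas: "\<And>z. z \<in> Z \<Longrightarrow> c z \<in> sets borel"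
    and p: "\<And>z. z \<in> Z \<Longrightarrow> p \<le> measure lborel (K \<inter> c z)"
  shows "2 powr (real (card Z) * (1 - exp (- (p * real n)))) \<le> expected_islands n K"
proof -
  interpret prob_space "uniform_sample n K" by (rule prob_space_uniform_sample[OF K])
  have prod: "integrable (uniform_sample n K) (\<lambda>x. \<Prod>i<n. 1 - indicat_real (c z) (x i))"
    "expectation (\<lambda>x. \<Prod>i<n. 1 - indicat_real (c z) (x i)) = (1 - measure lborel (K \<inter> c z)) ^ n"
    if "z \<in> Z" for z
    using prod_sample[OF K meas[OF that], where a = "-1" and n = n] by simp_all
  \<comment> \<open>The number of hit caps, written through products of indicators so that
    independence evaluates its expectation.\<close>
  define N where "N x = (\<Sum>z\<in>Z. 1 - (\<Prod>i<n. 1 - indicat_real (c z) (x i)))" for x :: "nat \<Rightarrow> 'a"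
  define a where "a = real (card Z) * (1 - exp (- (p * real n)))"
  have int: "integrable (uniform_sample n K) N"
    unfolding N_def using prod(1)
    by (intro Bochner_Integration.integrable_sum Bochner_Integration.integrable_diff) auto
  have "expectation N = (\<Sum>z\<in>Z. 1 - (1 - measure lborel (K \<inter> c z)) ^ n)"
    unfolding N_def using prod prob_space
    by (subst Bochner_Integration.integral_sum) auto
  also have "\<dots> \<ge> (\<Sum>z\<in>Z. 1 - exp (- (p * real n)))"
  proof (rule sum_mono)
    fix z assume z: "z \<in> Z"
    let ?m = "measure lborel (K \<inter> c z)"
    interpret U: prob_space "uniform_measure lborel K" by (rule prob_space_uniform[OF K])
    have m1: "?m \<le> 1" using U.prob_le_1[of "c z"] by (simp add: measure_uniform[OF K] meas[OF z])
    have "(1 - ?m) ^ n \<le> exp (- ?m) ^ n"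
      using m1 exp_ge_add_one_self[of "- ?m"] by (intro power_mono) auto
    also have "\<dots> = exp (- (?m * real n))" by (simp add: exp_of_nat2_mult[symmetric])
    also have "\<dots> \<le> exp (- (p * real n))" using p[OF z] by (simp add: mult_right_mono)
    finally show "1 - exp (- (p * real n)) \<le> 1 - (1 - ?m) ^ n" by simp
  qed
  finally have aN: "a \<le> expectation N" by (simp add: a_def)
  have N_eq: "N x = real (card {z \<in> Z. c z \<inter> x ` {..<n} \<noteq> {}})" for x
  proof -
    have "N x = (\<Sum>z\<in>Z. if c z \<inter> x ` {..<n} \<noteq> {} then 1 else 0)"
      unfolding N_def
    proof (rule sum.cong[OF refl])
      fix z
      show "1 - (\<Prod>i<n. 1 - indicat_real (c z) (x i)) = (if c z \<inter> x ` {..<n} \<noteq> {} then 1 else 0)"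
      proof (cases "c z \<inter> x ` {..<n} = {}")
        case True
        then have "(\<Prod>i<n. 1 - indicat_real (c z) (x i)) = 1"
          by (intro prod.neutral) (auto simp: indicator_def disjoint_iff)
        then show ?thesis using True by simp
      next
        case False
        then obtain i where "i < n" "x i \<in> c z" by auto
        then have "(\<Prod>i<n. 1 - indicat_real (c z) (x i)) = 0"
          by (intro prod_zero) (auto intro!: bexI[of _ i])
        then show ?thesis using False by simp
      qed
    qed
    also have "\<dots> = real (card {z \<in> Z. c z \<inter> x ` {..<n} \<noteq> {}})"
      using \<open>finite Z\<close> by (simp add: sum.If_cases Int_def)
    finally show ?thesis .
  qed
  \<comment> \<open>Jensen's inequality through the tangent at \<open>a\<close>\<close>
  have ge: "2 powr a * (1 + (N x - a) * ln 2) \<le> real (num_islands (x ` {..<n}))" for x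
  proof -
    have "2 powr a * (1 + (N x - a) * ln 2) \<le> 2 powr a * 2 powr (N x - a)"
      using exp_ge_add_one_self[of "(N x - a) * ln 2"] by (intro mult_left_mono) (auto simp: powr_def)
    also have "\<dots> = 2 powr N x" by (simp flip: powr_add)
    also have "\<dots> = real (2 ^ card {z \<in> Z. c z \<inter> x ` {..<n} \<noteq> {}})"
      by (simp add: N_eq powr_realpow)
    also have "\<dots> \<le> real (num_islands (x ` {..<n}))"
      by (intro of_nat_mono num_islands_ge_caps[OF _ \<open>finite Z\<close> disj sub conv]) auto
    finally show ?thesis .
  qed
  have "2 powr a \<le> 2 powr a * (1 + (expectation N - a) * ln 2)"
    using aN by (simp add: mult_left_mono)
  also have "\<dots> = expectation (\<lambda>x. 2 powr a * (1 + (N x - a) * ln 2))"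
    using int prob_space by simp
  also have "\<dots> \<le> expected_islands n K"
    unfolding expected_islands_def using int
    by (intro integral_mono ge integrable_num_islands[OF K]) auto
  finally show ?thesis unfolding a_def .
qed

section \<open>Disjoint caps of a paraboloid and their volumes\<close>

lemma prod_if_eq_UNIV:
  "(\<Prod>i\<in>(UNIV::'n::finite set). if i = k then a else b) = a * b ^ (CARD('n) - 1)"
  for a b :: "'a::comm_monoid_mult"
  by (subst prod.remove[of _ k]) (auto simp: card_Diff_singleton)

text \<open>The midpoint of a grid cell of side \<delta> in the hyperplane below the paraboloid.
  Coordinate \<open>k\<close> is 0 so that inner products with it involve the other coordinates
  only.\<close>

definition cap_centre :: "'n::finite \<Rightarrow> real \<Rightarrow> ('n \<Rightarrow> nat) \<Rightarrow> real^'n" where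
  "cap_centre k \<delta> z = (\<chi> i. if i = k then 0 else (real (z i) + 1 / 2) * \<delta>)"

definition paraboloid :: "'n::finite \<Rightarrow> real \<Rightarrow> (real^'n) set" where
  "paraboloid k b = {y. (\<forall>i. 0 \<le> y $ i \<and> y $ i \<le> b) \<and> (\<Sum>i\<in>UNIV - {k}. (y $ i)\<^sup>2) \<le> y $ k}"

text \<open>The cap is cut off by the tangent at the centre, raised by \<open>\<delta>\<^sup>2 / 4\<close>: on the paraboloid the defining
  inequality says that \<open>y\<close> is within \<open>\<delta> / 2\<close> of the centre in the coordinates other than \<open>k\<close>.\<close>

definition cap :: "'n::finite \<Rightarrow> real \<Rightarrow> real \<Rightarrow> ('n \<Rightarrow> nat) \<Rightarrow> (real^'n) set" where
  "cap k b \<delta> z = paraboloid k b \<inter>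
    {y. cap_centre k \<delta> z \<bullet> cap_centre k \<delta> z - \<delta>\<^sup>2 / 4 < (2 *\<^sub>R cap_centre k \<delta> z - axis k 1) \<bullet> y}"

lemma inner_cap_centre:
  "cap_centre k \<delta> z \<bullet> y = (\<Sum>i\<in>UNIV - {k}. cap_centre k \<delta> z $ i * y $ i)"
  unfolding inner_vec_def
  by (subst sum.remove[of _ k]) (auto simp: cap_centre_def)

lemma sum_diff_cap_centre:
  "(\<Sum>i\<in>UNIV - {k}. (y $ i - cap_centre k \<delta> z $ i)\<^sup>2)
    = (\<Sum>i\<in>UNIV - {k}. (y $ i)\<^sup>2) - 2 * (cap_centre k \<delta> z \<bullet> y) + cap_centre k \<delta> z \<bullet> cap_centre k \<delta> z"
  unfolding inner_cap_centre
  by (simp add: power2_diff sum.distrib sum_subtractf sum_distrib_left power2_eq_square algebra_simps)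

lemma convex_square_vec: "convex {y::real^'n. (\<Sum>i\<in>UNIV - {k}. (y $ i)\<^sup>2) \<le> y $ k}"
proof -
  have sq: "convex_on UNIV (\<lambda>y::real^'n. (y $ i)\<^sup>2)" for i
  proof (rule convex_onI)
    fix t :: real and x y :: "real^'n" assume "0 < t" "t < 1"
    then show "(((1 - t) *\<^sub>R x + t *\<^sub>R y) $ i)\<^sup>2 \<le> (1 - t) * (x $ i)\<^sup>2 + t * (y $ i)\<^sup>2"
      using convex_onD[OF convex_power2, of t "x $ i" "y $ i"] by simp
  qed auto
  show ?thesis
  proof (rule convexI, clarsimp simp del: vector_scaleR_component vector_add_component)
    fix x y :: "real^'n" and u v :: real
    assume x: "(\<Sum>i\<in>UNIV - {k}. (x $ i)\<^sup>2) \<le> x $ k" and y: "(\<Sum>i\<in>UNIV - {k}. (y $ i)\<^sup>2) \<le> y $ k"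
      and uv: "0 \<le> u" "0 \<le> v" "u + v = 1"
    have "(\<Sum>i\<in>UNIV - {k}. ((u *\<^sub>R x + v *\<^sub>R y) $ i)\<^sup>2) \<le> (\<Sum>i\<in>UNIV - {k}. u * (x $ i)\<^sup>2 + v * (y $ i)\<^sup>2)"
    proof (rule sum_mono)
      fix i
      have u: "u = 1 - v" using uv by simp
      show "((u *\<^sub>R x + v *\<^sub>R y) $ i)\<^sup>2 \<le> u * (x $ i)\<^sup>2 + v * (y $ i)\<^sup>2"
        unfolding u using convex_onD[OF sq, of v x y i] uv by simp
    qed
    also have "\<dots> = u * (\<Sum>i\<in>UNIV - {k}. (x $ i)\<^sup>2) + v * (\<Sum>i\<in>UNIV - {k}. (y $ i)\<^sup>2)"
      by (simp add: sum.distrib sum_distrib_left)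
    also have "\<dots> \<le> u * x $ k + v * y $ k"
      using x y uv by (intro add_mono mult_left_mono) auto
    finally show "(\<Sum>i\<in>UNIV - {k}. ((u *\<^sub>R x + v *\<^sub>R y) $ i)\<^sup>2) \<le> (u *\<^sub>R x + v *\<^sub>R y) $ k" by simp
  qed
qed

lemma convex_paraboloid: "convex (paraboloid k b)"
proof -
  have "paraboloid k b = cbox 0 (\<chi> i. b) \<inter> {y. (\<Sum>i\<in>UNIV - {k}. (y $ i)\<^sup>2) \<le> y $ k}"
    by (auto simp: paraboloid_def mem_box_cart)
  then show ?thesis using convex_square_vec by (auto intro: convex_Int convex_box)
qed

text \<open>A cap is cut off by an open halfspace, so removing caps means intersecting with closed
  halfspaces.\<close>

lemma convex_paraboloid_minus_caps: "convex (paraboloid k b - \<Union>(cap k b \<delta> ` T))"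
proof -
  have "paraboloid k b - \<Union>(cap k b \<delta> ` T) = paraboloid k b \<inter>
     (\<Inter>z\<in>T. {y. (2 *\<^sub>R cap_centre k \<delta> z - axis k 1) \<bullet> y \<le> cap_centre k \<delta> z \<bullet> cap_centre k \<delta> z - \<delta>\<^sup>2 / 4})"
    by (fastforce simp: cap_def not_less)
  then show ?thesis
    by (auto intro!: convex_Int convex_paraboloid convex_INT convex_halfspace_le)
qed

lemma borel_cap: "cap k b \<delta> z \<in> sets borel"
proof -
  have "closed (paraboloid k b)" unfolding paraboloid_def
    by (intro closed_Collect_conj closed_Collect_all closed_Collect_le continuous_intros)
  moreover have "open {y. cap_centre k \<delta> z \<bullet> cap_centre k \<delta> z - \<delta>\<^sup>2 / 4 < (2 *\<^sub>R cap_centre k \<delta> z - axis k 1) \<bullet> y}"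
    by (intro open_Collect_less continuous_intros)
  ultimately show ?thesis unfolding cap_def by (intro sets.Int) auto
qed

lemma cap_component:
  assumes "y \<in> cap k b \<delta> z" "i \<noteq> k" "\<delta> > 0"
  shows "\<bar>y $ i - cap_centre k \<delta> z $ i\<bar> < \<delta> / 2"
proof -
  have "(y $ i - cap_centre k \<delta> z $ i)\<^sup>2 \<le> (\<Sum>i\<in>UNIV - {k}. (y $ i - cap_centre k \<delta> z $ i)\<^sup>2)"
    using assms by (intro member_le_sum) auto
  also have "\<dots> < (\<delta> / 2)\<^sup>2"
    using assms(1) unfolding sum_diff_cap_centre
    by (auto simp: cap_def paraboloid_def inner_diff_left inner_axis' power2_eq_square)
  finally show ?thesis using assms(3) by (intro power2_less_imp_less[of "\<bar>_\<bar>"]) simp_all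
qed

text \<open>Indices are pinned to 0 at \<open>k\<close>, so distinct ones differ in another
  coordinate. There the centres are at least \<delta> apart, while each cap reaches less than
  \<open>\<delta> / 2\<close> from its centre.\<close>

lemma disjoint_caps:
  assumes "\<delta> > 0"
  shows "disjoint_family_on (cap k b \<delta>) (PiE UNIV (\<lambda>i. if i = k then {0} else {..<M}))"
proof (unfold disjoint_family_on_def, intro ballI impI)
  fix z z' assume z: "z \<in> PiE UNIV (\<lambda>i. if i = k then {0} else {..<M})"
    "z' \<in> PiE UNIV (\<lambda>i. if i = k then {0} else {..<M})" "z \<noteq> z'"
  from \<open>z \<noteq> z'\<close> obtain i where i: "z i \<noteq> z' i" by (auto simp: fun_eq_iff)
  have "z k = 0" "z' k = 0" using z by (auto simp: PiE_iff dest: spec[of _ k])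
  with i have "i \<noteq> k" by auto
  show "cap k b \<delta> z \<inter> cap k b \<delta> z' = {}"
  proof (rule ccontr)
    assume "cap k b \<delta> z \<inter> cap k b \<delta> z' \<noteq> {}"
    then obtain y where y: "y \<in> cap k b \<delta> z" "y \<in> cap k b \<delta> z'" by auto
    have "\<bar>(real (z i) + 1 / 2) * \<delta> - (real (z' i) + 1 / 2) * \<delta>\<bar> < \<delta>"
      using cap_component[OF y(1) \<open>i \<noteq> k\<close> assms] cap_component[OF y(2) \<open>i \<noteq> k\<close> assms] \<open>i \<noteq> k\<close>
      unfolding cap_centre_def vec_lambda_beta if_not_P[OF \<open>i \<noteq> k\<close>] abs_less_iff by linarith
    then have "\<bar>real (z i) - real (z' i)\<bar> * \<delta> < 1 * \<delta>"
      using assms by (simp add: abs_mult flip: left_diff_distrib)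
    then have "\<bar>real (z i) - real (z' i)\<bar> < 1" using assms by (simp only: mult_less_cancel_right_pos)
    then show False using i by linarith
  qed
qed

lemma emeasure_cap:
  fixes k :: "'n::finite"
  assumes M: "M > 0" and z: "\<And>i. i \<noteq> k \<Longrightarrow> z i < M"
    and b: "b = 1 / real CARD('n)" and \<delta>: "\<delta> = b / real M"
  shows "ennreal (\<delta>\<^sup>2 / 16 * (\<delta> * b / 2) ^ (CARD('n) - 1)) \<le> emeasure lborel (cap k b \<delta> z)"
proof -
  let ?p = "cap_centre k \<delta> z"
  \<comment> \<open>Since \<open>CARD('n) * b = 1\<close>, the squares of \<open>CARD('n)\<close>
    deviations of size \<eta> add up to \<open>b * \<delta>\<^sup>2 / 16\<close>, safely below the
    \<open>\<delta>\<^sup>2 / 8\<close> that the levels chosen next leave for them.\<close>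
  define \<eta> where "\<eta> = \<delta> * b / 4"
  have d: "real CARD('n) \<ge> 1" using zero_less_card_finite[where 'a='n] by linarith
  have b1: "0 < b" "b \<le> 1" "real CARD('n) * b = 1" unfolding b using d by auto
  have \<delta>0: "0 < \<delta>" "\<delta> \<le> b" "real M * \<delta> = b" unfolding \<delta> using b1 M by (auto simp: field_simps)
  have \<eta>0: "0 < \<eta>" "\<eta> \<le> \<delta> / 4" using \<delta>0 b1 by (auto simp: \<eta>_def)
  \<comment> \<open>Both levels of the tilted coordinate lie above the threshold
    \<open>\<delta>\<^sup>2 / 4\<close> below \<open>?p \<bullet> ?p\<close>, which puts the slab in
    the cap's halfspace. The upper one stays \<open>\<delta>\<^sup>2 / 8\<close> below
    \<open>?p \<bullet> ?p\<close>, which keeps the slab inside the paraboloid.\<close>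
  define l :: "real^'n" where "l = (\<chi> i. if i = k then ?p \<bullet> ?p - 3 * \<delta>\<^sup>2 / 16 else ?p $ i - \<eta>)"
  define u :: "real^'n" where "u = (\<chi> i. if i = k then ?p \<bullet> ?p - \<delta>\<^sup>2 / 8 else ?p $ i + \<eta>)"
  let ?S = "{x. (\<forall>i. i \<noteq> k \<longrightarrow> l $ i \<le> x $ i \<and> x $ i \<le> u $ i) \<and>
      l $ k \<le> (2 *\<^sub>R ?p) \<bullet> x - x $ k \<and> (2 *\<^sub>R ?p) \<bullet> x - x $ k \<le> u $ k}"
  have "emeasure lborel ?S = ennreal (\<Prod>i\<in>UNIV. u $ i - l $ i)"
    by (rule emeasure_slab) (use \<eta>0 in \<open>auto simp: l_def u_def cap_centre_def\<close>)
  also have "(\<Prod>i\<in>UNIV. u $ i - l $ i) = (\<Prod>i\<in>(UNIV::'n set). if i = k then \<delta>\<^sup>2 / 16 else \<delta> * b / 2)"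
    by (rule prod.cong) (auto simp: l_def u_def \<eta>_def)
  also have "\<dots> = \<delta>\<^sup>2 / 16 * (\<delta> * b / 2) ^ (CARD('n) - 1)" by (rule prod_if_eq_UNIV)
  finally have S: "emeasure lborel ?S = ennreal (\<delta>\<^sup>2 / 16 * (\<delta> * b / 2) ^ (CARD('n) - 1))" .
  have "?S \<subseteq> cap k b \<delta> z"
  proof
    fix y assume y: "y \<in> ?S"
    have yi: "\<bar>y $ i - ?p $ i\<bar> \<le> \<eta>" if "i \<noteq> k" for i
    proof -
      have "l $ i \<le> y $ i" "y $ i \<le> u $ i" using y that by auto
      then show ?thesis using that by (auto simp: l_def u_def)
    qed
    have yk: "?p \<bullet> ?p - 3 * \<delta>\<^sup>2 / 16 \<le> 2 * (?p \<bullet> y) - y $ k" "2 * (?p \<bullet> y) - y $ k \<le> ?p \<bullet> ?p - \<delta>\<^sup>2 / 8"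
      using y by (auto simp: l_def u_def)
    have yb: "0 \<le> y $ i \<and> y $ i \<le> b" if "i \<noteq> k" for i
    proof -
      have "\<bar>y $ i - ?p $ i\<bar> \<le> \<delta> / 2" using yi[OF that] \<eta>0 \<delta>0 by linarith
      moreover have "?p $ i = real (z i) * \<delta> + \<delta> / 2" using that by (simp add: cap_centre_def algebra_simps)
      moreover have "real (z i) * \<delta> + \<delta> \<le> b"
      proof -
        have "real (z i) + 1 \<le> real M" using z[OF that] by linarith
        then have "(real (z i) + 1) * \<delta> \<le> real M * \<delta>" using \<delta>0 by (intro mult_right_mono) auto
        then show ?thesis using \<delta>0 by (simp add: algebra_simps)
      qed
      moreover have "0 \<le> real (z i) * \<delta>" using \<delta>0 by simp
      ultimately show ?thesis using \<delta>0 unfolding abs_le_iff by linarith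
    qed
    have card: "real (card (UNIV - {k})) = real CARD('n) - 1"
      using d by (simp add: card_Diff_singleton of_nat_diff)
    have "(\<Sum>i\<in>UNIV - {k}. (y $ i - ?p $ i)\<^sup>2) \<le> (\<Sum>i\<in>UNIV - {k}. \<eta>\<^sup>2)"
      using yi \<eta>0 by (intro sum_mono) (auto simp: abs_le_square_iff[symmetric])
    also have "\<dots> \<le> real CARD('n) * \<eta>\<^sup>2" by (simp add: card algebra_simps)
    also have "\<dots> = (real CARD('n) * b) * b * \<delta>\<^sup>2 / 16" by (simp add: \<eta>_def power2_eq_square)
    also have "\<dots> \<le> \<delta>\<^sup>2 / 8"
    proof -
      have "b * \<delta>\<^sup>2 \<le> 1 * \<delta>\<^sup>2" using b1 by (intro mult_right_mono) auto
      then show ?thesis unfolding b1(3) using zero_le_power2[of \<delta>] by linarith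
    qed
    finally have "(\<Sum>i\<in>UNIV - {k}. (y $ i - ?p $ i)\<^sup>2) \<le> \<delta>\<^sup>2 / 8" .
    then have par: "(\<Sum>i\<in>UNIV - {k}. (y $ i)\<^sup>2) \<le> y $ k"
      using yk unfolding sum_diff_cap_centre by linarith
    have "0 \<le> (\<Sum>i\<in>UNIV - {k}. (y $ i - ?p $ i)\<^sup>2)" by (intro sum_nonneg) auto
    then have "y $ k \<le> (\<Sum>i\<in>UNIV - {k}. (y $ i)\<^sup>2) + \<delta>\<^sup>2"
      using yk zero_le_power2[of \<delta>] unfolding sum_diff_cap_centre by linarith
    \<comment> \<open>The choice \<open>b = 1 / d\<close> makes these \<open>d\<close> squares add
      up to exactly \<open>b\<close>, so the slab does not leave the box through its top.\<close>
    also have "\<dots> \<le> (\<Sum>i\<in>UNIV - {k}. b\<^sup>2) + b\<^sup>2"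
      using yb \<delta>0 by (intro add_mono sum_mono power_mono) auto
    also have "\<dots> = (real CARD('n) * b) * b" by (simp add: card power2_eq_square algebra_simps)
    finally have "y $ k \<le> b" unfolding b1(3) by simp
    moreover have "0 \<le> y $ k" using par by (rule order_trans[rotated]) (intro sum_nonneg, simp)
    ultimately have "\<forall>i. 0 \<le> y $ i \<and> y $ i \<le> b" using yb by metis
    moreover have "?p \<bullet> ?p - \<delta>\<^sup>2 / 4 < 2 * (?p \<bullet> y) - y $ k"
      using yk(1) zero_less_power[OF \<delta>0(1), of 2] by linarith
    ultimately show "y \<in> cap k b \<delta> z"
      using par by (auto simp: cap_def paraboloid_def inner_diff_left inner_axis')
  qed
  then show ?thesis unfolding S[symmetric] by (intro emeasure_mono) (use borel_cap in auto)
qed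

text \<open>With side \<open>\<delta> = b / M\<close> a cap contributes
  \<open>\<delta>\<^sup>2\<close> from its depth and \<open>\<delta> ^ (d - 1)\<close> from its
  base, hence the \<open>M ^ (d + 1)\<close> in the denominator. The factor
  \<open>(1 / 2) ^ CARD('n)\<close> is the lower bound for the scaling factor of the
  coordinates.\<close>

lemma expected_islands_lower_grid:
  fixes K :: "(real^'n) set"
  assumes K: "convex_body K" "measure lborel K = 1" and M: "M > 0"
    and b: "b = 1 / real CARD('n)"
  shows "2 powr (real M ^ (CARD('n) - 1) *
      (1 - exp (- ((1 / 2) ^ CARD('n) * (b\<^sup>2 / 16 * (b\<^sup>2 / 2) ^ (CARD('n) - 1)) / real M ^ (CARD('n) + 1) * real n))))
    \<le> expected_islands n K"
proof -
  \<comment> \<open>Any coordinate can serve as the axis of the paraboloid.\<close>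
  obtain k :: 'n where True by blast
  obtain g :: "real^'n \<Rightarrow> real^'n" and c where g: "continuous_on UNIV g" "\<And>S. convex S \<Longrightarrow> convex (g -` S)"
    and em: "\<And>S. S \<in> sets borel \<Longrightarrow> emeasure lborel (g -` S) = ennreal c * emeasure lborel S"
    and inner: "\<And>x. (\<forall>i. 0 \<le> g x $ i \<and> g x $ i \<le> 1 / real CARD('n)) \<Longrightarrow> x \<in> K"
    and c: "(1 / 2) ^ CARD('n) \<le> c"
    by (rule convex_body_coordinates[OF K]) metis
  define \<delta> where "\<delta> = b / real M"
  have "b > 0" using b by simp
  then have "\<delta> > 0" using M by (simp add: \<delta>_def)
  let ?Z = "PiE (UNIV::'n set) (\<lambda>i. if i = k then {0} else {..<M})"
  let ?P = "g -` paraboloid k b" and ?c = "\<lambda>z. g -` cap k b \<delta> z"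
  let ?p = "(1 / 2) ^ CARD('n) * (b\<^sup>2 / 16 * (b\<^sup>2 / 2) ^ (CARD('n) - 1)) / real M ^ (CARD('n) + 1)"
  have "card ?Z = (\<Prod>i\<in>(UNIV::'n set). if i = k then 1 else M)"
    by (subst card_PiE) (auto intro!: prod.cong)
  then have cardZ: "card ?Z = M ^ (CARD('n) - 1)" by (simp add: prod_if_eq_UNIV)
  have "2 powr (real (card ?Z) * (1 - exp (- (?p * real n)))) \<le> expected_islands n K"
  proof (rule expected_islands_ge_caps[OF K])
    show "finite ?Z" by (intro finite_PiE) auto
    show "disjoint_family_on ?c ?Z"
      using disjoint_caps[OF \<open>\<delta> > 0\<close>, of k b M] unfolding disjoint_family_on_def by auto
    show "?c z \<subseteq> ?P" if "z \<in> ?Z" for z by (auto simp: cap_def)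
    show "convex (?P - \<Union> (?c ` T))" if "T \<subseteq> ?Z" for T
    proof -
      have "?P - \<Union> (?c ` T) = g -` (paraboloid k b - \<Union> (cap k b \<delta> ` T))" by auto
      then show ?thesis using g(2)[OF convex_paraboloid_minus_caps] by simp
    qed
    show meas: "?c z \<in> sets borel" for z
      using measurable_sets_borel[OF borel_measurable_continuous_onI[OF g(1)] borel_cap] by simp
    show "?p \<le> measure lborel (K \<inter> ?c z)" if z: "z \<in> ?Z" for z
    proof -
      have "g x \<in> cap k b \<delta> z \<Longrightarrow> x \<in> K" for x
        using inner[of x] by (auto simp: cap_def paraboloid_def b)
      then have sub: "K \<inter> ?c z = ?c z" by auto
      have zi: "z i < M" if "i \<noteq> k" for i
        using PiE_mem[OF z, of i] that by simp
      have "CARD('n) + 1 = 2 + (CARD('n) - 1)" using zero_less_card_finite[where 'a='n] by linarith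
      then have "real M ^ (CARD('n) + 1) = (real M)\<^sup>2 * real M ^ (CARD('n) - 1)"
        by (simp only: power_add)
      then have "?p = (1 / 2) ^ CARD('n) * (\<delta>\<^sup>2 / 16 * (\<delta> * b / 2) ^ (CARD('n) - 1))"
        unfolding \<delta>_def by (simp add: power_divide power_mult_distrib power2_eq_square)
      also have "ennreal \<dots> = ennreal ((1 / 2) ^ CARD('n)) * ennreal (\<delta>\<^sup>2 / 16 * (\<delta> * b / 2) ^ (CARD('n) - 1))"
        by (rule ennreal_mult') (use \<open>\<delta> > 0\<close> \<open>b > 0\<close> in auto)
      also have "\<dots> \<le> ennreal c * emeasure lborel (cap k b \<delta> z)"
        by (intro mult_mono ennreal_leI c emeasure_cap[OF M zi b]) (auto simp: \<delta>_def)
      also have "\<dots> = emeasure lborel (K \<inter> ?c z)" unfolding sub by (simp add: em borel_cap)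
      also have "\<dots> = ennreal (measure lborel (K \<inter> ?c z))"
        using K(1) by (intro emeasure_lborel_bounded bounded_Int) (auto simp: convex_body_def compact_imp_bounded)
      finally show ?thesis by (simp add: ennreal_le_iff)
    qed
  qed
  then show ?thesis by (simp add: cardZ)
qed

section \<open>Convex functions on a grid\<close>

text \<open>The point is the average of the \<open>d\<close> points
  \<open>q + (H * s $ i) *\<^sub>R axis i 1\<close>, each on the segment from \<open>q\<close> to
  \<open>q + H *\<^sub>R axis i 1\<close>. Averaging divides by \<open>d\<close>, so a cell of side
  \<open>1/M\<close> calls for difference steps \<open>H = d / M\<close>.\<close>

lemma convex_affine_upper:
  fixes f :: "real^'n \<Rightarrow> real"
  assumes f: "convex_on UNIV f" and s: "\<And>i. 0 \<le> s $ i \<and> s $ i \<le> 1"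
  shows "f (q + (H / real CARD('n)) *\<^sub>R s)
    \<le> f q + (\<Sum>i\<in>UNIV. s $ i * (f (q + H *\<^sub>R axis i 1) - f q)) / real CARD('n)"
proof -
  let ?d = "real CARD('n)"
  have "q + (H / ?d) *\<^sub>R s = (\<Sum>i\<in>UNIV. (1 / ?d) *\<^sub>R (q + (H * s $ i) *\<^sub>R axis i 1))"
  proof -
    have "(\<Sum>i\<in>UNIV. (1 / ?d) *\<^sub>R (q + (H * s $ i) *\<^sub>R axis i 1))
      = q + (H / ?d) *\<^sub>R (\<Sum>i\<in>UNIV. s $ i *\<^sub>R axis i 1)"
      by (simp add: scaleR_add_right sum.distrib sum_constant_scaleR scaleR_sum_right del: sum_constant)
    also have "(\<Sum>i\<in>UNIV. s $ i *\<^sub>R axis i 1) = s"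
      using basis_expansion[of s] by (simp add: scalar_mult_eq_scaleR)
    finally show ?thesis by simp
  qed
  then have "f (q + (H / ?d) *\<^sub>R s) \<le> (\<Sum>i\<in>UNIV. (1 / ?d) * f (q + (H * s $ i) *\<^sub>R axis i 1))"
    using convex_on_sum[OF _ _ f, of "UNIV::'n set" "\<lambda>_. 1 / ?d" "\<lambda>i. q + (H * s $ i) *\<^sub>R axis i 1"] by simp
  also have "\<dots> \<le> (\<Sum>i\<in>UNIV. (1 / ?d) * (f q + s $ i * (f (q + H *\<^sub>R axis i 1) - f q)))"
  proof (intro sum_mono mult_left_mono)
    fix i
    have "q + (H * s $ i) *\<^sub>R axis i 1 = (1 - s $ i) *\<^sub>R q + s $ i *\<^sub>R (q + H *\<^sub>R axis i 1)"
      by (simp add: algebra_simps)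
    then show "f (q + (H * s $ i) *\<^sub>R axis i 1) \<le> f q + s $ i * (f (q + H *\<^sub>R axis i 1) - f q)"
      using convex_onD[OF f, of "s $ i" q "q + H *\<^sub>R axis i 1"] s by (simp add: algebra_simps)
  qed auto
  also have "\<dots> = f q + (\<Sum>i\<in>UNIV. s $ i * (f (q + H *\<^sub>R axis i 1) - f q)) / ?d"
    by (simp add: sum.distrib sum_divide_distrib add_divide_distrib)
  finally show ?thesis .
qed

lemma convex_second_difference_nonneg:
  assumes "convex_on UNIV f"
  shows "2 * f q \<le> f (q + v) + f (q - v)"
proof -
  have "q = (1 - 1 / 2) *\<^sub>R (q + v) + (1 / 2) *\<^sub>R (q - v)"
    by (simp add: algebra_simps flip: scaleR_add_left)
  then have "f q \<le> (1 - 1 / 2) * f (q + v) + (1 / 2) * f (q - v)"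
    using convex_onD[OF assms, of "1 / 2" "q + v" "q - v"] by simp
  then show ?thesis by simp
qed

text \<open>Reflecting at \<open>q\<close> turns the upper bound into a lower one, at the cost of second differences.\<close>

lemma convex_affine_lower:
  fixes f :: "real^'n \<Rightarrow> real"
  assumes f: "convex_on UNIV f" and s: "\<And>i. 0 \<le> s $ i \<and> s $ i \<le> 1"
  shows "f q + (\<Sum>i\<in>UNIV. s $ i * (f (q + H *\<^sub>R axis i 1) - f q)) / real CARD('n)
      - (\<Sum>i\<in>UNIV. f (q + H *\<^sub>R axis i 1) + f (q - H *\<^sub>R axis i 1) - 2 * f q) / real CARD('n)
    \<le> f (q + (H / real CARD('n)) *\<^sub>R s)"
proof -
  let ?d = "real CARD('n)"
  have 1: "2 * f q \<le> f (q + (H / ?d) *\<^sub>R s) + f (q - (H / ?d) *\<^sub>R s)"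
    by (rule convex_second_difference_nonneg[OF f])
  have "q - (H / ?d) *\<^sub>R s = q + ((- H) / ?d) *\<^sub>R s" by simp
  then have 2: "f (q - (H / ?d) *\<^sub>R s) \<le> f q + (\<Sum>i\<in>UNIV. s $ i * (f (q - H *\<^sub>R axis i 1) - f q)) / ?d"
    using convex_affine_upper[OF f s, of q "- H"] by simp
  have "(\<Sum>i\<in>UNIV. s $ i * (f (q - H *\<^sub>R axis i 1) - f q)) + (\<Sum>i\<in>UNIV. s $ i * (f (q + H *\<^sub>R axis i 1) - f q))
    = (\<Sum>i\<in>UNIV. s $ i * (f (q + H *\<^sub>R axis i 1) + f (q - H *\<^sub>R axis i 1) - 2 * f q))"
    by (simp add: algebra_simps flip: sum.distrib)
  also have "\<dots> \<le> (\<Sum>i\<in>UNIV. f (q + H *\<^sub>R axis i 1) + f (q - H *\<^sub>R axis i 1) - 2 * f q)"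
  proof (intro sum_mono)
    fix i
    show "s $ i * (f (q + H *\<^sub>R axis i 1) + f (q - H *\<^sub>R axis i 1) - 2 * f q)
      \<le> f (q + H *\<^sub>R axis i 1) + f (q - H *\<^sub>R axis i 1) - 2 * f q"
      using convex_second_difference_nonneg[OF f, of q "H *\<^sub>R axis i 1"] s[of i]
      by (intro mult_left_le_one_le) auto
  qed
  finally have "((\<Sum>i\<in>UNIV. s $ i * (f (q - H *\<^sub>R axis i 1) - f q)) + (\<Sum>i\<in>UNIV. s $ i * (f (q + H *\<^sub>R axis i 1) - f q))) / ?d
    \<le> (\<Sum>i\<in>UNIV. f (q + H *\<^sub>R axis i 1) + f (q - H *\<^sub>R axis i 1) - 2 * f q) / ?d"
    by (rule divide_right_mono) simp
  then show ?thesis using 1 2 unfolding add_divide_distrib by linarith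
qed

text \<open>The Lipschitz bound omits coordinate \<open>k\<close> and so makes \<open>f\<close>
  constant along it: functions of \<open>d - 1\<close> variables are kept on \<open>real^'n\<close>,
  without a second type. The bound at 0 confines the codes to a finite range.\<close>

definition lip_convex :: "'n::finite \<Rightarrow> (real^'n \<Rightarrow> real) \<Rightarrow> bool" where
  "lip_convex k f \<longleftrightarrow> convex_on UNIV f \<and> (\<forall>x y. f x - f y \<le> (\<Sum>i\<in>UNIV - {k}. \<bar>x $ i - y $ i\<bar>))
     \<and> \<bar>f 0\<bar> \<le> real CARD('n)"

definition grid_point :: "nat \<Rightarrow> ('n::finite \<Rightarrow> int) \<Rightarrow> real^'n" where
  "grid_point M z = (\<chi> i. real_of_int (z i) / real M)"

definition grid_code :: "nat \<Rightarrow> (real^'n \<Rightarrow> real) \<Rightarrow> ('n::finite \<Rightarrow> int) \<Rightarrow> int" where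
  "grid_code M f z = \<lfloor>(real M)\<^sup>2 * f (grid_point M z)\<rfloor>"

text \<open>The interpolation of \<open>convex_affine_upper\<close> with step \<open>d / M\<close>,
  but computed from integer codes, so that it depends on finitely many data.\<close>

definition affine_part :: "nat \<Rightarrow> 'n::finite \<Rightarrow> (('n \<Rightarrow> int) \<Rightarrow> int) \<Rightarrow> ('n \<Rightarrow> int) \<Rightarrow> real^'n \<Rightarrow> real" where
  "affine_part M k N z x = (real_of_int (N z)
     + (\<Sum>i\<in>UNIV - {k}. (real M * x $ i - real_of_int (z i)) *
         real_of_int (N (z(i := z i + int CARD('n))) - N z)) / real CARD('n)) / (real M)\<^sup>2"

text \<open>The leading 2 pays for rounding in the affine part. The 2 in each summand pays for
  rounding in a second difference and keeps the summand nonnegative.\<close>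

definition error_part :: "nat \<Rightarrow> 'n::finite \<Rightarrow> (('n \<Rightarrow> int) \<Rightarrow> int) \<Rightarrow> ('n \<Rightarrow> int) \<Rightarrow> real" where
  "error_part M k N z = (2 + (\<Sum>i\<in>UNIV - {k}. real_of_int
     (N (z(i := z i + int CARD('n))) + N (z(i := z i - int CARD('n))) - 2 * N z + 2))) / (real M)\<^sup>2"

definition grid_cell :: "nat \<Rightarrow> 'n::finite \<Rightarrow> ('n \<Rightarrow> int) \<Rightarrow> (real^'n) set" where
  "grid_cell M k z = {x. \<forall>i. i \<noteq> k \<longrightarrow> real_of_int (z i) \<le> real M * x $ i \<and> real M * x $ i \<le> real_of_int (z i) + 1}"

lemma grid_point_shift:
  assumes "M > 0"
  shows "grid_point M (z(i := z i + m)) = grid_point M z + (real_of_int m / real M) *\<^sub>R axis i 1"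
  by (auto simp: grid_point_def vec_eq_iff axis_def add_divide_distrib)

lemma grid_code_bounds:
  "real_of_int (grid_code M f z) \<le> (real M)\<^sup>2 * f (grid_point M z)"
  "(real M)\<^sup>2 * f (grid_point M z) < real_of_int (grid_code M f z) + 1"
  by (auto simp: grid_code_def)

text \<open>Rounding down loses less than 1 at each point. Convexity therefore gives a second
  difference of codes above -2, and integrality improves this to -1, which the encoding along lines
  exploits.\<close>

lemma grid_code_second_difference:
  assumes f: "convex_on UNIV f" and M: "M > 0"
  shows "(real M)\<^sup>2 * (f (grid_point M (z(i := z i + m))) + f (grid_point M (z(i := z i - m))) - 2 * f (grid_point M z))
      \<le> real_of_int (grid_code M f (z(i := z i + m)) + grid_code M f (z(i := z i - m)) - 2 * grid_code M f z + 2)"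
    and "grid_code M f (z(i := z i + m)) + grid_code M f (z(i := z i - m)) - 2 * grid_code M f z \<ge> - 1"
proof -
  let ?p = "(real M)\<^sup>2 * f (grid_point M (z(i := z i + m)))" and ?q = "(real M)\<^sup>2 * f (grid_point M (z(i := z i - m)))"
    and ?r = "(real M)\<^sup>2 * f (grid_point M z)"
  have e: "(real M)\<^sup>2 * (f (grid_point M (z(i := z i + m))) + f (grid_point M (z(i := z i - m))) - 2 * f (grid_point M z)) = ?p + ?q - 2 * ?r"
    by (simp add: algebra_simps)
  note b = grid_code_bounds[of M f z] grid_code_bounds[of M f "z(i := z i + m)"] grid_code_bounds[of M f "z(i := z i - m)"]
  show "(real M)\<^sup>2 * (f (grid_point M (z(i := z i + m))) + f (grid_point M (z(i := z i - m))) - 2 * f (grid_point M z))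
      \<le> real_of_int (grid_code M f (z(i := z i + m)) + grid_code M f (z(i := z i - m)) - 2 * grid_code M f z + 2)"
    unfolding e using b by simp
  have "grid_point M (z(i := z i - m)) = grid_point M z - (real_of_int m / real M) *\<^sub>R axis i 1"
    using grid_point_shift[OF M, of z i "- m"] by simp
  then have "2 * f (grid_point M z) \<le> f (grid_point M (z(i := z i + m))) + f (grid_point M (z(i := z i - m)))"
    using convex_second_difference_nonneg[OF f] grid_point_shift[OF M, of z i m] by simp
  then have "0 \<le> ?p + ?q - 2 * ?r" unfolding e[symmetric] by simp
  then have "real_of_int (grid_code M f (z(i := z i + m)) + grid_code M f (z(i := z i - m)) - 2 * grid_code M f z) > - 2"
    using b by simp
  then show "grid_code M f (z(i := z i + m)) + grid_code M f (z(i := z i - m)) - 2 * grid_code M f z \<ge> - 1"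
    by linarith
qed

lemma lip_convex_abs_diff:
  assumes "lip_convex k f"
  shows "\<bar>f x - f y\<bar> \<le> (\<Sum>i\<in>UNIV - {k}. \<bar>x $ i - y $ i\<bar>)"
proof -
  have "f x - f y \<le> (\<Sum>i\<in>UNIV - {k}. \<bar>x $ i - y $ i\<bar>)" "f y - f x \<le> (\<Sum>i\<in>UNIV - {k}. \<bar>y $ i - x $ i\<bar>)"
    using assms unfolding lip_convex_def by blast+
  then show ?thesis by (simp add: abs_minus_commute abs_le_iff)
qed

text \<open>Convexity encloses \<open>f\<close> around the interpolation of its true values.
  Replacing values by codes moves that interpolation by at most 2: by 1 at \<open>z\<close> itself
  and by 1 in the weighted differences, whose sum is divided by \<open>d\<close>.\<close>

lemma affine_part_error:
  fixes f :: "real^'n \<Rightarrow> real"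
  assumes f: "lip_convex k f" and M: "M > 0" and x: "x \<in> grid_cell M k z"
  shows "\<bar>f x - affine_part M k (grid_code M f) z x\<bar> \<le> error_part M k (grid_code M f) z"
proof -
  let ?d = "real CARD('n)" and ?N = "grid_code M f" and ?q = "grid_point M z" and ?M = "(real M)\<^sup>2"
  let ?z = "\<lambda>i. z(i := z i + int CARD('n))" and ?y = "\<lambda>i. z(i := z i - int CARD('n))"
  define H where "H = ?d / real M"
  have cf: "convex_on UNIV f" using f by (simp add: lip_convex_def)
  have d: "?d \<ge> 1" using zero_less_card_finite[where 'a='n] by linarith
  have M2: "?M > 0" using M by simp
  define s :: "real^'n" where "s = (\<chi> i. if i = k then 0 else real M * x $ i - real_of_int (z i))"
  have s: "0 \<le> s $ i \<and> s $ i \<le> 1" for i using x by (auto simp: s_def grid_cell_def)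
  have gz: "grid_point M (?z i) = ?q + H *\<^sub>R axis i 1" for i
    using grid_point_shift[OF M, of z i "int CARD('n)"] by (simp add: H_def)
  have gy: "grid_point M (?y i) = ?q - H *\<^sub>R axis i 1" for i
    using grid_point_shift[OF M, of z i "- int CARD('n)"] by (simp add: H_def)
  have "f (?q + (H / ?d) *\<^sub>R s) = f x"
  proof -
    have "(?q + (H / ?d) *\<^sub>R s) $ i = x $ i" if "i \<noteq> k" for i
      using that M by (simp add: grid_point_def s_def H_def field_simps)
    then show ?thesis using lip_convex_abs_diff[OF f, of "?q + (H / ?d) *\<^sub>R s" x] by simp
  qed
  then have up: "f x \<le> f ?q + (\<Sum>i\<in>UNIV. s $ i * (f (grid_point M (?z i)) - f ?q)) / ?d"
    and lo: "f ?q + (\<Sum>i\<in>UNIV. s $ i * (f (grid_point M (?z i)) - f ?q)) / ?d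
      - (\<Sum>i\<in>UNIV. f (grid_point M (?z i)) + f (grid_point M (?y i)) - 2 * f ?q) / ?d \<le> f x"
    using convex_affine_upper[OF cf s, of ?q H] convex_affine_lower[OF cf s, of ?q H] unfolding gz gy by auto
  \<comment> \<open>Constancy along coordinate \<open>k\<close> removes the terms with index
    \<open>k\<close> from both sums.\<close>
  have fk: "f (grid_point M (?z k)) = f ?q" "f (grid_point M (?y k)) = f ?q"
    using lip_convex_abs_diff[OF f, of "grid_point M (?z k)" ?q] lip_convex_abs_diff[OF f, of "grid_point M (?y k)" ?q]
    by (simp_all add: grid_point_def)
  have S: "(\<Sum>i\<in>UNIV. s $ i * (f (grid_point M (?z i)) - f ?q))
      = (\<Sum>i\<in>UNIV - {k}. s $ i * (f (grid_point M (?z i)) - f ?q))"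
    by (subst sum.remove[of _ k]) (auto simp: fk)
  have R: "(\<Sum>i\<in>UNIV. f (grid_point M (?z i)) + f (grid_point M (?y i)) - 2 * f ?q)
      = (\<Sum>i\<in>UNIV - {k}. f (grid_point M (?z i)) + f (grid_point M (?y i)) - 2 * f ?q)"
    by (subst sum.remove[of _ k]) (auto simp: fk)
  \<comment> \<open>The rounding loss of the code at a grid point, a number in
    \<open>[0, 1]\<close>.\<close>
  define \<theta> where "\<theta> w = ?M * f (grid_point M w) - real_of_int (?N w)" for w
  have \<theta>: "0 \<le> \<theta> w" "\<theta> w \<le> 1" for w using grid_code_bounds[of M f w] by (auto simp: \<theta>_def)
  define A where "A = ?M * (f ?q + (\<Sum>i\<in>UNIV - {k}. s $ i * (f (grid_point M (?z i)) - f ?q)) / ?d)"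
  have "?M * affine_part M k ?N z x = real_of_int (?N z) + (\<Sum>i\<in>UNIV - {k}. s $ i * real_of_int (?N (?z i) - ?N z)) / ?d"
    using M2 unfolding affine_part_def by (simp add: s_def)
  also have "\<dots> = A - \<theta> z - (\<Sum>i\<in>UNIV - {k}. s $ i * (\<theta> (?z i) - \<theta> z)) / ?d"
    unfolding A_def \<theta>_def
    by (simp add: distrib_left right_diff_distrib sum_subtractf sum_distrib_left diff_divide_distrib ac_simps)
  finally have aff: "?M * affine_part M k ?N z x = A - \<theta> z - (\<Sum>i\<in>UNIV - {k}. s $ i * (\<theta> (?z i) - \<theta> z)) / ?d" .
  have "\<bar>(\<Sum>i\<in>UNIV - {k}. s $ i * (\<theta> (?z i) - \<theta> z))\<bar> \<le> (\<Sum>i\<in>UNIV - {k}. \<bar>s $ i * (\<theta> (?z i) - \<theta> z)\<bar>)"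
    by (rule sum_abs)
  also have "\<dots> \<le> (\<Sum>i\<in>UNIV - {k}. 1)"
  proof (rule sum_mono)
    fix i
    have "\<bar>s $ i\<bar> \<le> 1" "\<bar>\<theta> (?z i) - \<theta> z\<bar> \<le> 1" using s[of i] \<theta>[of z] \<theta>[of "?z i"] by auto
    then show "\<bar>s $ i * (\<theta> (?z i) - \<theta> z)\<bar> \<le> 1" unfolding abs_mult using mult_mono[of "\<bar>s $ i\<bar>" 1 "\<bar>\<theta> (?z i) - \<theta> z\<bar>" 1] by simp
  qed
  also have "\<dots> \<le> ?d" using card_mono[of "UNIV::'n set" "UNIV - {k}"] by simp
  finally have "\<bar>(\<Sum>i\<in>UNIV - {k}. s $ i * (\<theta> (?z i) - \<theta> z)) / ?d\<bar> \<le> 1" using d by simp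
  then have A: "\<bar>?M * affine_part M k ?N z x - A\<bar> \<le> 2"
    unfolding aff abs_le_iff using \<theta>[of z] by linarith
  let ?R = "(\<Sum>i\<in>UNIV - {k}. real_of_int (?N (?z i) + ?N (?y i) - 2 * ?N z + 2))"
  have R_le: "?M * (\<Sum>i\<in>UNIV - {k}. f (grid_point M (?z i)) + f (grid_point M (?y i)) - 2 * f ?q) \<le> ?R"
    unfolding sum_distrib_left by (intro sum_mono grid_code_second_difference(1)[OF cf M])
  have R0: "?R \<ge> 0"
    using grid_code_second_difference(2)[OF cf M, of z _ "int CARD('n)"] by (intro sum_nonneg) (smt (verit) of_int_0_le_iff)
  have "?M * ((\<Sum>i\<in>UNIV - {k}. f (grid_point M (?z i)) + f (grid_point M (?y i)) - 2 * f ?q) / ?d) \<le> ?R / ?d"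
    using divide_right_mono[OF R_le, of ?d] by simp
  also have "\<dots> \<le> ?R" using R0 d by (simp add: divide_le_eq mult_le_cancel_left1)
  finally have R': "?M * ((\<Sum>i\<in>UNIV - {k}. f (grid_point M (?z i)) + f (grid_point M (?y i)) - 2 * f ?q) / ?d) \<le> ?R" .
  have "?M * f x \<le> A" unfolding A_def using up M2 unfolding S by simp
  moreover have "A - ?R \<le> ?M * f x"
  proof -
    have "A - ?M * ((\<Sum>i\<in>UNIV - {k}. f (grid_point M (?z i)) + f (grid_point M (?y i)) - 2 * f ?q) / ?d) \<le> ?M * f x"
      unfolding A_def right_diff_distrib[symmetric] using lo M2 unfolding S R by simp
    then show ?thesis using R' by linarith
  qed
  ultimately have "\<bar>?M * f x - ?M * affine_part M k ?N z x\<bar> \<le> 2 + ?R" using A R0 by (auto simp: abs_le_iff)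
  then have "?M * \<bar>f x - affine_part M k ?N z x\<bar> \<le> 2 + ?R"
    using M2 by (simp add: right_diff_distrib[symmetric] abs_mult)
  then show ?thesis unfolding error_part_def using M2 by (simp add: pos_le_divide_eq mult.commute)
qed

section \<open>Volume of the uncertainty shell\<close>

lemma prod_if_if_eq_UNIV:
  fixes a b c :: "'a::comm_monoid_mult" and i k :: "'n::finite"
  assumes "i \<noteq> k"
  shows "(\<Prod>j\<in>UNIV. if j = k then a else if j = i then b else c) = a * b * c ^ (CARD('n) - 2)"
proof -
  have "(\<Prod>j\<in>UNIV. if j = k then a else if j = i then b else c)
    = a * (\<Prod>j\<in>UNIV - {k}. if j = k then a else if j = i then b else c)"
    by (subst prod.remove[of _ k]) auto
  also have "(\<Prod>j\<in>UNIV - {k}. if j = k then a else if j = i then b else c)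
    = b * (\<Prod>j\<in>UNIV - {k} - {i}. if j = k then a else if j = i then b else c)"
    using assms by (subst prod.remove[of _ i]) auto
  also have "(\<Prod>j\<in>UNIV - {k} - {i}. if j = k then a else if j = i then b else c) = c ^ card (UNIV - {k} - {i})"
    by (subst prod.cong[of _ _ _ "\<lambda>_. c"]) auto
  also have "card (UNIV - {k} - {i}) = CARD('n) - 2"
    using assms by (simp add: card_Diff_singleton)
  finally show ?thesis by (simp add: mult.assoc)
qed

text \<open>Terms over \<open>Z \<inter> Z'\<close> cancel, and what remains is bounded term by
  term.\<close>

lemma sum_diff_le_card:
  fixes u :: "'b \<Rightarrow> real"
  assumes "finite Z" "finite Z'" "\<And>z. \<bar>u z\<bar> \<le> B"
    and "card (Z - Z') \<le> m" "card (Z' - Z) \<le> m"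
  shows "sum u Z - sum u Z' \<le> 2 * B * real m"
proof -
  have B: "B \<ge> 0" using assms(3)[of undefined] by linarith
  have "sum u Z = sum u (Z \<inter> Z') + sum u (Z - Z')"
    using \<open>finite Z\<close> by (subst sum.Int_Diff[of Z u Z']) auto
  moreover have "sum u Z' = sum u (Z \<inter> Z') + sum u (Z' - Z)"
    using \<open>finite Z'\<close> by (subst sum.Int_Diff[of Z' u Z]) (auto simp: Int_commute)
  moreover have "sum u (Z - Z') \<le> (\<Sum>z\<in>Z - Z'. B)" using assms(3) by (intro sum_mono) (auto simp: abs_le_iff)
  moreover have "(\<Sum>z\<in>Z' - Z. - B) \<le> sum u (Z' - Z)"
  proof (intro sum_mono)
    fix z show "- B \<le> u z" using assms(3)[of z] by linarith
  qed
  moreover have "B * real (card (Z - Z')) \<le> B * real m" "B * real (card (Z' - Z)) \<le> B * real m"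
    using B assms(4,5) by (auto intro: mult_left_mono)
  ultimately show ?thesis by (simp add: algebra_simps)
qed

text \<open>The upper end \<open>M\<close> is included because the floor of \<open>M * x $ j\<close>
  equals \<open>M\<close> at \<open>x $ j = 1\<close>.\<close>

definition cell_index :: "nat \<Rightarrow> 'n::finite \<Rightarrow> ('n \<Rightarrow> int) set" where
  "cell_index M k = PiE UNIV (\<lambda>j. if j = k then {0} else {- int M..int M})"

lemma cell_index_iff:
  "z \<in> cell_index M k \<longleftrightarrow> z k = 0 \<and> (\<forall>j. j \<noteq> k \<longrightarrow> - int M \<le> z j \<and> z j \<le> int M)"
  unfolding cell_index_def PiE_iff by (auto split: if_splits)

lemma finite_cell_index: "finite (cell_index M k)"
  unfolding cell_index_def by (intro finite_PiE) auto

lemma card_cell_index: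
  "card (cell_index M (k::'n::finite)) = (2 * M + 1) ^ (CARD('n) - 1)"
proof -
  have "card (cell_index M k) = (\<Prod>j\<in>(UNIV::'n set). if j = k then 1 else 2 * M + 1)"
    unfolding cell_index_def by (subst card_PiE) (auto intro!: prod.cong)
  then show ?thesis by (simp add: prod_if_eq_UNIV)
qed

lemma card_slice:
  fixes i k :: "'n::finite"
  assumes "i \<noteq> k"
  shows "card (PiE (UNIV::'n set) (\<lambda>j. if j = k then {0} else if j = i then {a..<a + int m} else {- int M..int M}))
    = m * (2 * M + 1) ^ (CARD('n) - 2)"
proof -
  have "card (PiE (UNIV::'n set) (\<lambda>j. if j = k then {0} else if j = i then {a..<a + int m} else {- int M..int M}))
     = (\<Prod>j\<in>(UNIV::'n set). if j = k then 1 else if j = i then m else 2 * M + 1)"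
    by (subst card_PiE) (auto intro!: prod.cong)
  then show ?thesis using assms by (simp add: prod_if_if_eq_UNIV)
qed

text \<open>The second difference at \<open>z\<close> is \<open>u z - u (sh z)\<close> for the first
  difference \<open>u\<close> and the shift \<open>sh\<close> by \<open>m\<close>. The sum
  telescopes to two boundary slices of thickness \<open>m\<close> in direction \<open>i\<close>,
  which have one dimension less in \<open>M\<close>.\<close>

lemma sum_second_difference_le:
  fixes N :: "('n::finite \<Rightarrow> int) \<Rightarrow> int"
  assumes "i \<noteq> k" and B: "\<And>z. \<bar>N (z(i := z i + int m)) - N z\<bar> \<le> B"
  shows "(\<Sum>z\<in>cell_index M k. real_of_int (N (z(i := z i + int m)) + N (z(i := z i - int m)) - 2 * N z))
    \<le> 2 * real_of_int B * real (m * (2 * M + 1) ^ (CARD('n) - 2))"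
proof -
  define u where "u z = real_of_int (N (z(i := z i + int m)) - N z)" for z
  define sh where "sh z = z(i := z i - int m)" for z :: "'n \<Rightarrow> int"
  let ?Z = "cell_index M k"
  have inj: "inj sh"
  proof (rule injI)
    fix z z' assume "sh z = sh z'"
    then have "sh z j = sh z' j" for j by simp
    then have "z j = z' j" for j unfolding sh_def by (metis diff_left_imp_eq fun_upd_apply diff_add_cancel)
    then show "z = z'" by auto
  qed
  have "(\<Sum>z\<in>?Z. real_of_int (N (z(i := z i + int m)) + N (z(i := z i - int m)) - 2 * N z))
    = (\<Sum>z\<in>?Z. u z - u (sh z))"
    by (rule sum.cong) (auto simp: u_def sh_def)
  also have "\<dots> = sum u ?Z - sum u (sh ` ?Z)"
    using inj by (simp add: sum_subtractf sum.reindex inj_on_subset)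
  also have "\<dots> \<le> 2 * real_of_int B * real (m * (2 * M + 1) ^ (CARD('n) - 2))"
  proof (rule sum_diff_le_card)
    show "finite ?Z" "finite (sh ` ?Z)" by (simp_all add: finite_cell_index)
    show "\<bar>u z\<bar> \<le> real_of_int B" for z using B[of z] unfolding u_def by linarith
    let ?S = "\<lambda>a. PiE (UNIV::'n set) (\<lambda>j. if j = k then {0} else if j = i then {a..<a + int m} else {- int M..int M})"
    have fin: "finite (?S a)" for a by (intro finite_PiE) auto
    have "?Z - sh ` ?Z \<subseteq> ?S (int M + 1 - int m)"
    proof
      fix z assume z: "z \<in> ?Z - sh ` ?Z"
      then have zj: "z k = 0" "\<And>j. j \<noteq> k \<Longrightarrow> - int M \<le> z j \<and> z j \<le> int M"
        by (auto simp: cell_index_iff)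
      have zi: "- int M \<le> z i + int m" "z i - int m \<le> int M" using zj(2)[OF \<open>i \<noteq> k\<close>] by auto
      have "z i + int m > int M"
      proof (rule ccontr)
        assume "\<not> z i + int m > int M"
        then have "z(i := z i + int m) \<in> ?Z"
          using zj zi \<open>i \<noteq> k\<close> by (auto simp: cell_index_iff)
        moreover have "sh (z(i := z i + int m)) = z" by (auto simp: sh_def)
        ultimately show False using z by (metis DiffD2 image_eqI)
      qed
      then show "z \<in> ?S (int M + 1 - int m)" using zj zi \<open>i \<noteq> k\<close> by (auto simp: PiE_iff)
    qed
    from card_mono[OF fin this] show "card (?Z - sh ` ?Z) \<le> m * (2 * M + 1) ^ (CARD('n) - 2)"
      by (simp only: card_slice[OF \<open>i \<noteq> k\<close>])
    have "sh ` ?Z - ?Z \<subseteq> ?S (- int M - int m)"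
    proof
      fix y assume y: "y \<in> sh ` ?Z - ?Z"
      then obtain z where z: "z \<in> ?Z" "y = sh z" by auto
      from z(1) have zj: "z k = 0" "\<And>j. j \<noteq> k \<Longrightarrow> - int M \<le> z j \<and> z j \<le> int M"
        by (auto simp: cell_index_iff)
      have zi: "- int M \<le> z i + int m" "z i - int m \<le> int M" using zj(2)[OF \<open>i \<noteq> k\<close>] by auto
      have "z i - int m < - int M"
      proof (rule ccontr)
        assume "\<not> z i - int m < - int M"
        then have "y \<in> ?Z"
          using zj zi \<open>i \<noteq> k\<close> unfolding z(2) sh_def by (auto simp: cell_index_iff)
        then show False using y by blast
      qed
      then show "y \<in> ?S (- int M - int m)" using zj zi \<open>i \<noteq> k\<close> unfolding z(2) sh_def by (auto simp: PiE_iff)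
    qed
    from card_mono[OF fin this] show "card (sh ` ?Z - ?Z) \<le> m * (2 * M + 1) ^ (CARD('n) - 2)"
      by (simp only: card_slice[OF \<open>i \<noteq> k\<close>])
  qed
  finally show ?thesis .
qed

lemma grid_code_diff:
  fixes f :: "real^'n \<Rightarrow> real"
  assumes f: "lip_convex k f" and M: "M > 0"
  shows "\<bar>grid_code M f (z(i := z i + int m)) - grid_code M f z\<bar> \<le> int (m * M + 1)"
proof -
  let ?x = "grid_point M (z(i := z i + int m))" and ?y = "grid_point M z"
  have "\<bar>f ?x - f ?y\<bar> \<le> (\<Sum>j\<in>UNIV - {k}. \<bar>?x $ j - ?y $ j\<bar>)" by (rule lip_convex_abs_diff[OF f])
  also have "\<dots> \<le> (\<Sum>j\<in>UNIV. \<bar>?x $ j - ?y $ j\<bar>)" by (rule sum_mono2) auto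
  also have "\<dots> = (\<Sum>j\<in>UNIV. if j = i then real m / real M else 0)"
    by (rule sum.cong) (auto simp: grid_point_def add_divide_distrib)
  also have "\<dots> = real m / real M" by simp
  finally have "(real M)\<^sup>2 * \<bar>f ?x - f ?y\<bar> \<le> (real M)\<^sup>2 * (real m / real M)" by (rule mult_left_mono) simp
  also have "\<dots> = real (m * M)" using M by (simp add: power2_eq_square)
  finally have "\<bar>(real M)\<^sup>2 * f ?x - (real M)\<^sup>2 * f ?y\<bar> \<le> real (m * M)"
    by (simp add: abs_mult flip: right_diff_distrib)
  then have "\<bar>real_of_int (grid_code M f (z(i := z i + int m)) - grid_code M f z)\<bar> < real (m * M) + 1"
    using grid_code_bounds[of M f z] grid_code_bounds[of M f "z(i := z i + int m)"] unfolding of_int_diff by linarith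
  then show ?thesis by linarith
qed

lemma error_part_nonneg:
  fixes f :: "real^'n \<Rightarrow> real"
  assumes f: "lip_convex k f" and M: "M > 0"
  shows "0 \<le> error_part M k (grid_code M f) z"
proof -
  have cf: "convex_on UNIV f" using f by (simp add: lip_convex_def)
  have "0 \<le> (\<Sum>i\<in>UNIV - {k}. real_of_int (grid_code M f (z(i := z i + int CARD('n)))
      + grid_code M f (z(i := z i - int CARD('n))) - 2 * grid_code M f z + 2))"
    using grid_code_second_difference(2)[OF cf M, of z _ "int CARD('n)"] by (intro sum_nonneg) (smt (verit) of_int_0_le_iff)
  then show ?thesis unfolding error_part_def by simp
qed

text \<open>The outer 2 is the two-sided thickness and \<open>3 ^ (d - 1)\<close> comes from
  \<open>2 * M + 1 <= 3 * M\<close>. In the bracket, \<open>2 + 2 * d\<close> collects the rounding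
  terms and the rest the telescoped second differences.\<close>

definition shell_volume :: "nat \<Rightarrow> real" where
  "shell_volume d = 2 * 3 ^ (d - 1) * (2 + 2 * real d + 2 * (real d)\<^sup>2 * (real d + 1))"

text \<open>First differences of the codes are of order \<open>M\<close> and the boundary slices
  have order \<open>M ^ (d - 2)\<close> cells. So the second differences sum to order
  \<open>M ^ (d - 1)\<close>, a bounded amount per cell on average, although a single one may be of
  order \<open>M\<close>.\<close>

lemma sum_error_part_le:
  fixes f :: "real^'n \<Rightarrow> real"
  assumes f: "lip_convex k f" and M: "M > 0" and d: "CARD('n) \<ge> 2"
  shows "(\<Sum>z\<in>cell_index M k. 2 * error_part M k (grid_code M f) z) / real M ^ (CARD('n) - 1)
    \<le> shell_volume CARD('n) / (real M)\<^sup>2"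
proof -
  let ?d = "CARD('n)" and ?Z = "cell_index M k" and ?N = "grid_code M f"
  let ?T = "\<lambda>i z. real_of_int (?N (z(i := z i + int ?d)) + ?N (z(i := z i - int ?d)) - 2 * ?N z)"
  let ?c = "(3 * real M) ^ (?d - 1)"
  have cardZ: "real (card ?Z) \<le> ?c"
    unfolding card_cell_index of_nat_power using M by (intro power_mono) auto
  have T: "(\<Sum>z\<in>?Z. ?T i z) \<le> 2 * real ?d * (real ?d + 1) * ?c" if "i \<noteq> k" for i
  proof -
    have "(\<Sum>z\<in>?Z. ?T i z) \<le> 2 * real_of_int (int (?d * M + 1)) * real (?d * (2 * M + 1) ^ (?d - 2))"
      by (rule sum_second_difference_le[OF that]) (rule grid_code_diff[OF f M])
    also have "\<dots> = 2 * real ?d * (real (?d * M + 1) * real (2 * M + 1) ^ (?d - 2))" by simp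
    also have "\<dots> \<le> 2 * real ?d * ((real ?d + 1) * real M * (3 * real M) ^ (?d - 2))"
      using M by (intro mult_left_mono mult_mono power_mono) (auto simp: algebra_simps)
    also have "\<dots> \<le> 2 * real ?d * ((real ?d + 1) * (3 * real M) * (3 * real M) ^ (?d - 2))"
      by (intro mult_left_mono mult_right_mono) auto
    also have "\<dots> = 2 * real ?d * (real ?d + 1) * ((3 * real M) * (3 * real M) ^ (?d - 2))" by simp
    also have "(3 * real M) * (3 * real M) ^ (?d - 2) = ?c"
      using d by (metis Suc_diff_le diff_Suc_Suc numeral_2_eq_2 power_Suc diff_Suc_1 One_nat_def)
    finally show ?thesis .
  qed
  have "(real M)\<^sup>2 * (\<Sum>z\<in>?Z. error_part M k ?N z)
    = (\<Sum>z\<in>?Z. 2 + (\<Sum>i\<in>UNIV - {k}. ?T i z + 2))"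
    unfolding sum_distrib_left error_part_def using M by (intro sum.cong) auto
  also have "\<dots> = 2 * real (card ?Z) + (\<Sum>i\<in>UNIV - {k}. (\<Sum>z\<in>?Z. ?T i z) + 2 * real (card ?Z))"
    by (simp only: sum.distrib sum.swap[of _ _ "?Z"] sum_constant) simp
  also have "\<dots> \<le> 2 * ?c + (\<Sum>i\<in>UNIV - {k}. 2 * real ?d * (real ?d + 1) * ?c + 2 * ?c)"
    using cardZ T by (intro add_mono sum_mono) auto
  also have "\<dots> = 2 * ?c + real (card (UNIV - {k})) * ((2 * real ?d * (real ?d + 1) + 2) * ?c)"
    by (simp add: algebra_simps)
  also have "\<dots> \<le> 2 * ?c + real ?d * ((2 * real ?d * (real ?d + 1) + 2) * ?c)"
    by (intro add_left_mono mult_right_mono of_nat_mono card_mono) auto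
  also have "\<dots> = (2 + 2 * real ?d + 2 * (real ?d)\<^sup>2 * (real ?d + 1)) * ?c"
    by (simp add: algebra_simps power2_eq_square)
  finally have *: "(real M)\<^sup>2 * (\<Sum>z\<in>?Z. error_part M k ?N z)
    \<le> (2 + 2 * real ?d + 2 * (real ?d)\<^sup>2 * (real ?d + 1)) * ?c" .
  have "(\<Sum>z\<in>?Z. 2 * error_part M k ?N z) / real M ^ (?d - 1) =
     2 * ((real M)\<^sup>2 * (\<Sum>z\<in>?Z. error_part M k ?N z)) / (real M ^ (?d - 1) * (real M)\<^sup>2)"
    using M by (simp flip: sum_distrib_left)
  also have "\<dots> \<le> 2 * ((2 + 2 * real ?d + 2 * (real ?d)\<^sup>2 * (real ?d + 1)) * ?c) / (real M ^ (?d - 1) * (real M)\<^sup>2)"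
    by (intro divide_right_mono mult_left_mono *) auto
  also have "\<dots> = shell_volume ?d / (real M)\<^sup>2"
    using M by (simp add: shell_volume_def power_mult_distrib)
  finally show ?thesis .
qed

section \<open>Volume of the shell over one cell and over all cells\<close>

definition cell_shell :: "nat \<Rightarrow> 'n::finite \<Rightarrow> real \<Rightarrow> (('n \<Rightarrow> int) \<Rightarrow> int) \<Rightarrow> ('n \<Rightarrow> int) \<Rightarrow> (real^'n) set" where
  "cell_shell M k \<sigma> N z = {x \<in> grid_cell M k z. \<bar>\<sigma> * x $ k - affine_part M k N z x\<bar> \<le> error_part M k N z}"

text \<open>Multiplying the defining difference by \<open>- \<sigma>\<close> turns the coefficient
  of \<open>x $ k\<close> into -1 without changing the absolute value. The piece of the shell is
  then a slab of known volume.\<close>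

lemma cell_shell_measure:
  fixes k :: "'n::finite"
  assumes M: "M > 0" and \<sigma>: "\<sigma> = 1 \<or> \<sigma> = -1" and r: "0 \<le> error_part M k N z"
  shows "cell_shell M k \<sigma> N z \<in> sets borel"
    and "emeasure lborel (cell_shell M k \<sigma> N z) = ennreal (2 * error_part M k N z / real M ^ (CARD('n) - 1))"
proof -
  let ?r = "error_part M k N z"
  define D where "D i = real_of_int (N (z(i := z i + int CARD('n))) - N z) / real CARD('n) / (real M)\<^sup>2" for i
  define v :: "real^'n" where "v = (\<chi> i. if i = k then 0 else \<sigma> * real M * D i)"
  define a where "a = real_of_int (N z) / (real M)\<^sup>2 - (\<Sum>i\<in>UNIV - {k}. real_of_int (z i) * D i)"
  have \<sigma>2: "\<sigma> * \<sigma> = 1" "\<bar>\<sigma>\<bar> = 1" using \<sigma> by auto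
  have vx: "v \<bullet> x = \<sigma> * (\<Sum>i\<in>UNIV - {k}. real M * x $ i * D i)" for x
    unfolding inner_vec_def by (subst sum.remove[of _ k]) (auto simp: v_def sum_distrib_left ac_simps intro!: sum.cong)
  have aff: "affine_part M k N z x = a + \<sigma> * (v \<bullet> x)" for x
  proof -
    have "affine_part M k N z x = real_of_int (N z) / (real M)\<^sup>2 + (\<Sum>i\<in>UNIV - {k}. (real M * x $ i - real_of_int (z i)) * D i)"
      unfolding affine_part_def D_def by (simp add: add_divide_distrib sum_divide_distrib)
    also have "\<dots> = a + (\<Sum>i\<in>UNIV - {k}. real M * x $ i * D i)"
      unfolding a_def by (simp add: left_diff_distrib sum_subtractf)
    also have "(\<Sum>i\<in>UNIV - {k}. real M * x $ i * D i) = \<sigma> * (v \<bullet> x)"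
      unfolding vx by (simp add: \<sigma>2 flip: mult.assoc)
    finally show ?thesis .
  qed
  define l :: "real^'n" where "l = (\<chi> i. if i = k then - (\<sigma> * a) - ?r else real_of_int (z i) / real M)"
  define u :: "real^'n" where "u = (\<chi> i. if i = k then - (\<sigma> * a) + ?r else (real_of_int (z i) + 1) / real M)"
  have abs_eq: "\<bar>\<sigma> * x $ k - affine_part M k N z x\<bar> = \<bar>v \<bullet> x - x $ k + \<sigma> * a\<bar>" for x
  proof -
    have "\<bar>\<sigma> * x $ k - affine_part M k N z x\<bar> = \<bar>- \<sigma>\<bar> * \<bar>\<sigma> * x $ k - affine_part M k N z x\<bar>" using \<sigma>2 by simp
    also have "\<dots> = \<bar>\<sigma> * \<sigma> * (v \<bullet> x) - \<sigma> * \<sigma> * x $ k + \<sigma> * a\<bar>"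
      unfolding aff abs_mult[symmetric] by (simp add: algebra_simps)
    finally show ?thesis by (simp add: \<sigma>2)
  qed
  have eq: "cell_shell M k \<sigma> N z = {x. (\<forall>i. i \<noteq> k \<longrightarrow> l $ i \<le> x $ i \<and> x $ i \<le> u $ i) \<and>
      l $ k \<le> v \<bullet> x - x $ k \<and> v \<bullet> x - x $ k \<le> u $ k}"
    unfolding cell_shell_def grid_cell_def abs_eq using M
    by (auto simp: l_def u_def field_simps abs_le_iff)
  show "cell_shell M k \<sigma> N z \<in> sets borel" unfolding eq using closed_slab by (rule borel_closed)
  have "emeasure lborel (cell_shell M k \<sigma> N z) = ennreal (\<Prod>i\<in>UNIV. u $ i - l $ i)"
    unfolding eq by (rule emeasure_slab) (use r M in \<open>auto simp: v_def l_def u_def field_simps\<close>)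
  also have "(\<Prod>i\<in>UNIV. u $ i - l $ i) = (\<Prod>i\<in>(UNIV::'n set). if i = k then 2 * ?r else 1 / real M)"
    by (rule prod.cong) (auto simp: l_def u_def add_divide_distrib)
  also have "\<dots> = 2 * ?r / real M ^ (CARD('n) - 1)" unfolding prod_if_eq_UNIV by (simp add: power_one_over)
  finally show "emeasure lborel (cell_shell M k \<sigma> N z) = ennreal (2 * ?r / real M ^ (CARD('n) - 1))" .
qed

lemma shell_measure:
  fixes f :: "real^'n \<Rightarrow> real"
  assumes f: "lip_convex k f" and M: "M > 0" and d: "CARD('n) \<ge> 2" and \<sigma>: "\<sigma> = 1 \<or> \<sigma> = -1"
  shows "emeasure lborel (\<Union>z\<in>cell_index M k. cell_shell M k \<sigma> (grid_code M f) z)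
    \<le> ennreal (shell_volume CARD('n) / (real M)\<^sup>2)"
proof -
  have "emeasure lborel (\<Union>z\<in>cell_index M k. cell_shell M k \<sigma> (grid_code M f) z)
    \<le> (\<Sum>z\<in>cell_index M k. emeasure lborel (cell_shell M k \<sigma> (grid_code M f) z))"
    using cell_shell_measure(1)[OF M \<sigma> error_part_nonneg[OF f M]]
    by (intro emeasure_subadditive_finite finite_cell_index) auto
  also have "\<dots> = (\<Sum>z\<in>cell_index M k. ennreal (2 * error_part M k (grid_code M f) z / real M ^ (CARD('n) - 1)))"
    by (intro sum.cong refl cell_shell_measure(2)[OF M \<sigma> error_part_nonneg[OF f M]])
  also have "\<dots> = ennreal (\<Sum>z\<in>cell_index M k. 2 * error_part M k (grid_code M f) z / real M ^ (CARD('n) - 1))"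
    using error_part_nonneg[OF f M] by (intro sum_ennreal) auto
  also have "\<dots> \<le> ennreal (shell_volume CARD('n) / (real M)\<^sup>2)"
    using sum_error_part_le[OF f M d] by (intro ennreal_leI) (simp add: sum_divide_distrib)
  finally show ?thesis .
qed

section \<open>Number of grid codes\<close>

text \<open>A strictly increasing sequence enumerates its image in order. At a first disagreement,
  each of the two values would have to occur in the other sequence no earlier, which forces both
  inequalities between them.\<close>

lemma strictly_increasing_eq_of_image_eq:
  fixes a b :: "int \<Rightarrow> int"
  assumes a: "\<And>s t. lo \<le> s \<Longrightarrow> s < t \<Longrightarrow> t < hi \<Longrightarrow> a s < a t"
    and b: "\<And>s t. lo \<le> s \<Longrightarrow> s < t \<Longrightarrow> t < hi \<Longrightarrow> b s < b t"
    and img: "a ` {lo..<hi} = b ` {lo..<hi}"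
    and t: "lo \<le> t" "t < hi"
  shows "a t = b t"
  using t
proof (induction "nat (t - lo)" arbitrary: t rule: less_induct)
  case less
  have IH: "a s = b s" if "lo \<le> s" "s < t" for s
    using less.hyps[of s] less.prems that by auto
  have "a t \<in> b ` {lo..<hi}" "b t \<in> a ` {lo..<hi}" using img less.prems by auto
  then obtain s s' where s: "lo \<le> s" "s < hi" "a t = b s" and s': "lo \<le> s'" "s' < hi" "b t = a s'" by auto
  have "s \<ge> t" using IH[of s] a[of s t] s less.prems by force
  then have "b t \<le> a t" using b[of t s] s less.prems by (cases "s = t") auto
  moreover have "s' \<ge> t" using IH[of s'] b[of s' t] s' less.prems by force
  then have "a t \<le> b t" using a[of t s'] s' less.prems by (cases "s' = t") auto
  ultimately show ?case by simp
qed

text \<open>Used with the line codes as \<open>\<Phi>\<close> and the bracket as \<open>h\<close>: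
  the infinite family of functions is counted through its finitely many possible records.\<close>

lemma card_image_le_of_factor:
  assumes "finite Y" "\<Phi> ` X \<subseteq> Y" "\<And>x y. x \<in> X \<Longrightarrow> y \<in> X \<Longrightarrow> \<Phi> x = \<Phi> y \<Longrightarrow> h x = h y"
  shows "finite (h ` X)" "card (h ` X) \<le> card Y"
proof -
  define r where "r y = h (SOME x. x \<in> X \<and> \<Phi> x = y)" for y
  have "h x = r (\<Phi> x)" if "x \<in> X" for x
  proof -
    have "(SOME x'. x' \<in> X \<and> \<Phi> x' = \<Phi> x) \<in> X \<and> \<Phi> (SOME x'. x' \<in> X \<and> \<Phi> x' = \<Phi> x) = \<Phi> x"
      by (rule someI[of _ x]) (use that in auto)
    then show ?thesis unfolding r_def using assms(3) that by metis
  qed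
  then have sub: "h ` X \<subseteq> r ` Y" using assms(2) by auto
  then show "finite (h ` X)" using assms(1) finite_subset by blast
  have "card (h ` X) \<le> card (r ` Y)" using sub assms(1) by (intro card_mono) auto
  also have "\<dots> \<le> card Y" using assms(1) by (rule card_image_le)
  finally show "card (h ` X) \<le> card Y" .
qed

text \<open>The margin \<open>CARD('n)\<close> beyond \<open>M\<close> is there because the error on
  a cell refers to codes \<open>CARD('n)\<close> grid steps away on either side.\<close>

definition code_index :: "nat \<Rightarrow> 'n::finite \<Rightarrow> ('n \<Rightarrow> int) set" where
  "code_index M k = {z. z k = 0 \<and> (\<forall>j. j \<noteq> k \<longrightarrow> \<bar>z j\<bar> \<le> int (M + CARD('n)))}"

text \<open>One start point, at the low end, for each grid line in direction
  \<open>i\<close>.\<close>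

definition line_index :: "nat \<Rightarrow> 'n::finite \<Rightarrow> 'n \<Rightarrow> ('n \<Rightarrow> int) set" where
  "line_index M k i = PiE UNIV (\<lambda>j. if j = k then {0} else if j = i then {- int (M + CARD('n))}
     else {- int (M + CARD('n))..int (M + CARD('n))})"

text \<open>Along a line the second differences of the code are at least \<open>-1\<close>, so its first differences
  become strictly increasing after adding \<open>2 t\<close> and can be stored as a mere set.\<close>

definition line_code :: "nat \<Rightarrow> 'n::finite \<Rightarrow> (real^'n \<Rightarrow> real) \<Rightarrow> ('n \<Rightarrow> int) \<Rightarrow> int \<times> int set" where
  "line_code M i f z = (grid_code M f z,
     (\<lambda>t. grid_code M f (z(i := t + 1)) - grid_code M f (z(i := t)) + 2 * t)
       ` {- int (M + CARD('n))..<int (M + CARD('n))})"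

lemma line_increments_strict:
  assumes f: "convex_on UNIV f" and M: "M > 0" and "s < t"
  shows "grid_code M f (z(i := s + 1)) - grid_code M f (z(i := s)) + 2 * s
    < grid_code M f (z(i := t + 1)) - grid_code M f (z(i := t)) + 2 * t"
  using \<open>s < t\<close>
proof (induction t rule: int_gr_induct)
  case base
  then show ?case
    using grid_code_second_difference(2)[OF f M, of "z(i := s + 1)" i 1]
    by (simp del: fun_upd_apply add: fun_upd_same)
next
  case (step t)
  then show ?case
    using grid_code_second_difference(2)[OF f M, of "z(i := t + 1)" i 1]
    by (simp del: fun_upd_apply add: fun_upd_same)
qed

text \<open>Strict monotonicity recovers the order of the stored increments, and summing them from
  the start value rebuilds the code along the whole line.\<close>

lemma grid_code_eq_of_line_code_eq:
  fixes f f' :: "real^'n \<Rightarrow> real"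
  assumes f: "convex_on UNIV f" "convex_on UNIV f'" and M: "M > 0" and "i \<noteq> k"
    and eq: "\<And>z. z \<in> line_index M k i \<Longrightarrow> line_code M i f z = line_code M i f' z"
    and z: "z \<in> code_index M k"
  shows "grid_code M f z = grid_code M f' z"
proof -
  let ?h = "int (M + CARD('n))"
  define y where "y = z(i := - ?h)"
  have y: "y \<in> line_index M k i"
    using z \<open>i \<noteq> k\<close> unfolding line_index_def PiE_iff y_def code_index_def
    by (auto simp: abs_le_iff minus_le_iff)
  have zi: "- ?h \<le> z i" "z i \<le> ?h"
    using z \<open>i \<noteq> k\<close> unfolding code_index_def by (auto simp: abs_le_iff minus_le_iff)
  from eq[OF y] have e0: "grid_code M f y = grid_code M f' y"
    and img: "(\<lambda>t. grid_code M f (y(i := t + 1)) - grid_code M f (y(i := t)) + 2 * t) ` {- ?h..<?h}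
      = (\<lambda>t. grid_code M f' (y(i := t + 1)) - grid_code M f' (y(i := t)) + 2 * t) ` {- ?h..<?h}"
    by (auto simp: line_code_def)
  have incr: "grid_code M f (y(i := t + 1)) - grid_code M f (y(i := t)) + 2 * t
     = grid_code M f' (y(i := t + 1)) - grid_code M f' (y(i := t)) + 2 * t" if "- ?h \<le> t" "t < ?h" for t
    by (rule strictly_increasing_eq_of_image_eq[OF _ _ img that]) (intro line_increments_strict f M; assumption)+
  have "t \<le> ?h \<longrightarrow> grid_code M f (y(i := t)) = grid_code M f' (y(i := t))" if "- ?h \<le> t" for t
    using that
  proof (induction t rule: int_ge_induct)
    case base
    have "y(i := - ?h) = y" by (auto simp: y_def)
    then show ?case using e0 by simp
  next
    case (step t)
    then show ?case using incr[of t] by (auto simp del: fun_upd_apply)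
  qed
  moreover have "y(i := z i) = z" by (auto simp: y_def)
  ultimately show ?thesis using zi by metis
qed

lemma grid_code_abs_le:
  fixes f :: "real^'n \<Rightarrow> real"
  assumes f: "lip_convex k f" and M: "M > 0" and z: "z \<in> code_index M k"
  shows "\<bar>grid_code M f z\<bar> \<le> int ((M * (CARD('n) + 1))\<^sup>2)"
proof -
  let ?d = "real CARD('n)"
  have d: "?d \<ge> 1" using zero_less_card_finite[where 'a='n] by linarith
  have zj: "\<bar>real_of_int (z j)\<bar> \<le> real M + ?d" if "j \<noteq> k" for j
    using z that unfolding code_index_def by (auto simp flip: of_int_abs)
  have "\<bar>f (grid_point M z) - f 0\<bar> \<le> (\<Sum>j\<in>UNIV - {k}. \<bar>grid_point M z $ j - 0 $ j\<bar>)" by (rule lip_convex_abs_diff[OF f])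
  also have "\<dots> \<le> (\<Sum>j\<in>UNIV - {k}. 1 + ?d)"
  proof (rule sum_mono)
    fix j assume "j \<in> UNIV - {k}"
    then have "\<bar>real_of_int (z j)\<bar> / real M \<le> (real M + ?d) / real M" using zj by (intro divide_right_mono) auto
    also have "\<dots> \<le> 1 + ?d" using M by (simp add: add_divide_distrib divide_le_eq mult_le_cancel_left1)
    finally show "\<bar>grid_point M z $ j - 0 $ j\<bar> \<le> 1 + ?d" using M by (simp add: grid_point_def)
  qed
  also have "\<dots> = real (card (UNIV - {k})) * (1 + ?d)" by simp
  also have "\<dots> \<le> ?d * (1 + ?d)" by (intro mult_right_mono of_nat_mono card_mono) auto
  finally have "\<bar>f (grid_point M z)\<bar> \<le> ?d * (1 + ?d) + ?d" using f unfolding lip_convex_def by linarith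
  then have "(real M)\<^sup>2 * \<bar>f (grid_point M z)\<bar> \<le> (real M)\<^sup>2 * (?d * (1 + ?d) + ?d)" by (intro mult_left_mono) auto
  then have "\<bar>(real M)\<^sup>2 * f (grid_point M z)\<bar> \<le> (real M)\<^sup>2 * (?d * (1 + ?d) + ?d)" by (simp add: abs_mult)
  moreover have "(real M)\<^sup>2 \<ge> 1" using M by simp
  \<comment> \<open>The rounding unit is enlarged to \<open>(real M)\<^sup>2\<close>, which
    completes the square \<open>(d + 1)\<^sup>2\<close>.\<close>
  ultimately have "\<bar>real_of_int (grid_code M f z)\<bar> \<le> (real M)\<^sup>2 * (?d * (1 + ?d) + ?d) + (real M)\<^sup>2"
    using grid_code_bounds[of M f z] by linarith
  also have "\<dots> = real ((M * (CARD('n) + 1))\<^sup>2)" by (simp add: power2_eq_square algebra_simps)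
  finally show ?thesis by linarith
qed

text \<open>Increments are at most \<open>M + 1\<close> in modulus and the added
  \<open>2 * t\<close> at most \<open>2 * (M + d)\<close>, so the stored set lies in an interval of
  length \<open>O(M)\<close>. This gives \<open>O(M)\<close> bits per line instead of
  \<open>log M\<close> bits per point.\<close>

lemma line_code_mem:
  fixes f :: "real^'n \<Rightarrow> real"
  assumes f: "lip_convex k f" and M: "M > 0" and "i \<noteq> k" and z: "z \<in> line_index M k i"
  defines "W \<equiv> int ((M * (CARD('n) + 1))\<^sup>2)" and "V \<equiv> int (M * (2 * CARD('n) + 4))"
  shows "line_code M i f z \<in> {- W..W} \<times> Pow {- V..V}"
proof -
  let ?h = "int (M + CARD('n))"
  have "z j \<in> (if j = k then {0} else if j = i then {- ?h} else {- ?h..?h})" for j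
    using z unfolding line_index_def by (auto simp: PiE_iff)
  from this[of k] this have "z k = 0" "\<bar>z j\<bar> \<le> ?h" if "j \<noteq> k" for j
    using that by (auto simp: abs_le_iff minus_le_iff split: if_splits dest!: meta_spec[of _ j])
  then have "z \<in> code_index M k" unfolding code_index_def using \<open>i \<noteq> k\<close> by auto
  then have 1: "\<bar>grid_code M f z\<bar> \<le> W" unfolding W_def by (rule grid_code_abs_le[OF f M])
  have "grid_code M f (z(i := t + 1)) - grid_code M f (z(i := t)) + 2 * t \<in> {- V..V}" if "- ?h \<le> t" "t < ?h" for t
  proof -
    have "\<bar>grid_code M f (z(i := t + 1)) - grid_code M f (z(i := t))\<bar> \<le> int (M + 1)"
      using grid_code_diff[OF f M, of "z(i := t)" i 1] by simp
    moreover have "\<bar>2 * t\<bar> \<le> 2 * ?h" using that by auto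
    moreover have "int (M + 1) + 2 * ?h \<le> V"
    proof -
      have "(M + 1) + 2 * (M + CARD('n)) \<le> M * (2 * CARD('n) + 4)"
        using M by (cases M) (simp_all add: algebra_simps)
      then show ?thesis unfolding V_def by linarith
    qed
    ultimately show ?thesis unfolding atLeastAtMost_iff by linarith
  qed
  then show ?thesis using 1 unfolding line_code_def by (auto simp: abs_le_iff)
qed

text \<open>Up to powers of \<open>M\<close>: \<open>6 * d + 12\<close> bits per line for start
  value and increments, times \<open>(2 * d + 3) ^ (d - 2)\<close> for the number of lines.\<close>

definition code_exponent :: "nat \<Rightarrow> nat" where
  "code_exponent d = (6 * d + 12) * (2 * d + 3) ^ (d - 2)"

lemma card_line_codes:
  fixes i k :: "'n::finite"
  assumes M: "M > 0" and "i \<noteq> k"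
  defines "W \<equiv> int ((M * (CARD('n) + 1))\<^sup>2)" and "V \<equiv> int (M * (2 * CARD('n) + 4))"
  shows "finite (PiE (line_index M k i) (\<lambda>_. {- W..W} \<times> Pow {- V..V}))"
    and "card (PiE (line_index M k i) (\<lambda>_. {- W..W} \<times> Pow {- V..V}))
      \<le> 2 ^ (code_exponent CARD('n) * M ^ (CARD('n) - 1))"
proof -
  let ?d = "CARD('n)" and ?L = "line_index M k i"
  have "?d \<ge> 2"
  proof -
    have "card {i, k} \<le> ?d" by (rule card_mono) auto
    then show ?thesis using \<open>i \<noteq> k\<close> by simp
  qed
  have finL: "finite ?L" unfolding line_index_def by (intro finite_PiE) auto
  then show "finite (PiE ?L (\<lambda>_. {- W..W} \<times> Pow {- V..V}))" by (intro finite_PiE) auto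
  have "card ?L = (\<Prod>j\<in>(UNIV::'n set). if j = k then 1 else if j = i then 1 else 2 * (M + ?d) + 1)"
    unfolding line_index_def by (subst card_PiE) (auto intro!: prod.cong)
  also have "\<dots> = (2 * (M + ?d) + 1) ^ (?d - 2)" by (simp only: prod_if_if_eq_UNIV[OF \<open>i \<noteq> k\<close>] mult_1_left)
  also have "\<dots> \<le> ((2 * ?d + 3) * M) ^ (?d - 2)"
  proof (rule power_mono)
    show "2 * (M + ?d) + 1 \<le> (2 * ?d + 3) * M"
      using M by (cases M) (simp_all add: algebra_simps)
  qed simp
  finally have cardL: "card ?L \<le> (2 * ?d + 3) ^ (?d - 2) * M ^ (?d - 2)" by (simp add: power_mult_distrib)
  define m where "m = M * (?d + 1)"
  have card_sym: "card {- int w..int w} = 2 * w + 1" for w by simp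
  \<comment> \<open>A start value needs only logarithmically many bits in \<open>m\<close>; the
    crude linear count is still of the order spent on the increments.\<close>
  have cW: "card {- W..W} \<le> 2 ^ (2 * m + 1)"
  proof -
    have "card {- W..W} = 2 * m\<^sup>2 + 1" unfolding W_def m_def by (rule card_sym)
    also have "\<dots> \<le> 2 * (m + 1)\<^sup>2" by (simp add: power2_eq_square)
    also have "\<dots> \<le> 2 * (2 ^ m)\<^sup>2"
      by (intro mult_left_mono power_mono) (use less_exp[of m] in \<open>auto simp: Suc_leI\<close>)
    also have "\<dots> = 2 ^ (2 * m + 1)" by (simp add: power_mult mult.commute flip: power_mult)
    finally show ?thesis .
  qed
  have cV: "card (Pow {- V..V}) = 2 ^ (2 * (M * (2 * ?d + 4)) + 1)"
    unfolding V_def by (simp only: card_Pow finite_atLeastAtMost_int card_sym)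
  have "card ({- W..W} \<times> Pow {- V..V}) \<le> 2 ^ (2 * m + 1) * 2 ^ (2 * (M * (2 * ?d + 4)) + 1)"
    unfolding card_cartesian_product cV using cW by (rule mult_right_mono) simp
  also have "\<dots> = 2 ^ ((2 * m + 1) + (2 * (M * (2 * ?d + 4)) + 1))" by (simp only: power_add)
  also have "\<dots> \<le> 2 ^ ((6 * ?d + 12) * M)"
    using M by (intro power_increasing) (auto simp: m_def algebra_simps)
  finally have cWV: "card ({- W..W} \<times> Pow {- V..V}) \<le> 2 ^ ((6 * ?d + 12) * M)" .
  have "card (PiE ?L (\<lambda>_. {- W..W} \<times> Pow {- V..V})) = card ({- W..W} \<times> Pow {- V..V}) ^ card ?L"
    using finL by (subst card_PiE) auto
  also have "\<dots> \<le> (2 ^ ((6 * ?d + 12) * M)) ^ card ?L" using cWV by (rule power_mono) simp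
  also have "\<dots> \<le> (2 ^ ((6 * ?d + 12) * M)) ^ ((2 * ?d + 3) ^ (?d - 2) * M ^ (?d - 2))"
    using cardL by (intro power_increasing) auto
  also have "\<dots> = 2 ^ ((6 * ?d + 12) * M * ((2 * ?d + 3) ^ (?d - 2) * M ^ (?d - 2)))"
    by (simp only: power_mult)
  also have "(6 * ?d + 12) * M * ((2 * ?d + 3) ^ (?d - 2) * M ^ (?d - 2)) = code_exponent ?d * (M * M ^ (?d - 2))"
    unfolding code_exponent_def by (simp only: ac_simps)
  also have "M * M ^ (?d - 2) = M ^ (?d - 1)"
    using \<open>?d \<ge> 2\<close> by (metis Suc_diff_le diff_Suc_Suc numeral_2_eq_2 power_Suc diff_Suc_1 One_nat_def)
  finally show "card (PiE ?L (\<lambda>_. {- W..W} \<times> Pow {- V..V})) \<le> 2 ^ (code_exponent ?d * M ^ (?d - 1))" .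
qed

text \<open>Outside the shell \<open>\<sigma> * x $ k\<close> is farther from the affine part than
  \<open>f x\<close> can be, so comparing with the affine part gives the same answer as comparing
  with \<open>f\<close>. Affine parts and shell depend on the code alone, hence functions with equal
  line codes share a bracket.\<close>

lemma epigraph_brackets:
  fixes k :: "'n::finite"
  assumes M: "M > 0" and d: "CARD('n) \<ge> 2" and \<sigma>: "\<sigma> = 1 \<or> \<sigma> = -1"
  shows "\<exists>\<F> :: ((real^'n) set \<times> (real^'n) set) set. finite \<F>
    \<and> card \<F> \<le> 2 ^ (code_exponent CARD('n) * M ^ (CARD('n) - 1))
    \<and> (\<forall>(B, D)\<in>\<F>. D \<in> sets borel \<and> emeasure lborel D \<le> ennreal (shell_volume CARD('n) / (real M)\<^sup>2))
    \<and> (\<forall>f. lip_convex k f \<longrightarrow>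
        (\<exists>(B, D)\<in>\<F>. \<forall>x. (\<forall>i. \<bar>x $ i\<bar> \<le> 1) \<longrightarrow> x \<notin> D \<longrightarrow> (f x \<le> \<sigma> * x $ k \<longleftrightarrow> x \<in> B)))"
proof -
  have "\<exists>i. i \<noteq> k"
  proof (rule ccontr)
    assume "\<nexists>i. i \<noteq> k"
    then have "(UNIV :: 'n set) = {k}" by auto
    then have "CARD('n) = 1" by (metis card_1_singleton_iff One_nat_def)
    then show False using d by simp
  qed
  then obtain i where i: "i \<noteq> k" by auto
  define R where "R f = restrict (grid_code M f) (code_index M k)" for f :: "real^'n \<Rightarrow> real"
  define Bf where "Bf N = {x. \<exists>z\<in>cell_index M k. x \<in> grid_cell M k z \<and> affine_part M k N z x \<le> \<sigma> * x $ k}" for N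
  define Df where "Df N = (\<Union>z\<in>cell_index M k. cell_shell M k \<sigma> N z)" for N
  define \<F> where "\<F> = (\<lambda>f. (Bf (R f), Df (R f))) ` {f. lip_convex k f}"
  let ?W = "int ((M * (CARD('n) + 1))\<^sup>2)" and ?V = "int (M * (2 * CARD('n) + 4))"
  let ?Y = "PiE (line_index M k i) (\<lambda>_. {- ?W..?W} \<times> Pow {- ?V..?V})"
  let ?\<Phi> = "\<lambda>f. restrict (line_code M i f) (line_index M k i)"
  have \<Phi>Y: "?\<Phi> ` {f. lip_convex k f} \<subseteq> ?Y"
    using line_code_mem[OF _ M i] by (intro image_subsetI PiE_I) auto
  have fac: "(Bf (R f), Df (R f)) = (Bf (R f'), Df (R f'))"
    if "f \<in> {f. lip_convex k f}" "f' \<in> {f. lip_convex k f}" "?\<Phi> f = ?\<Phi> f'" for f f'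
  proof -
    have "line_code M i f z = line_code M i f' z" if z: "z \<in> line_index M k i" for z
      using fun_cong[OF \<open>?\<Phi> f = ?\<Phi> f'\<close>, of z] z by simp
    then have "grid_code M f z = grid_code M f' z" if "z \<in> code_index M k" for z
      using that \<open>f \<in> _\<close> \<open>f' \<in> _\<close>
      by (intro grid_code_eq_of_line_code_eq[OF _ _ M i]) (auto simp: lip_convex_def)
    then have "R f = R f'" unfolding R_def by (intro restrict_ext) auto
    then show ?thesis by simp
  qed
  note card = card_image_le_of_factor[where h = "\<lambda>f. (Bf (R f), Df (R f))", OF card_line_codes(1)[OF M i] \<Phi>Y fac, folded \<F>_def]
  have R: "affine_part M k (R f) z x = affine_part M k (grid_code M f) z x"
    "error_part M k (R f) z = error_part M k (grid_code M f) z" if z: "z \<in> cell_index M k" for f z x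
  proof -
    have zk: "z k = 0" "\<And>j. j \<noteq> k \<Longrightarrow> \<bar>z j\<bar> \<le> int M"
      using z by (auto simp: cell_index_iff abs_le_iff minus_le_iff)
    have "z \<in> code_index M k"
      unfolding code_index_def using zk(1) order_trans[OF zk(2)] by auto
    moreover have "z(j := z j + int CARD('n)) \<in> code_index M k" "z(j := z j - int CARD('n)) \<in> code_index M k"
      if "j \<noteq> k" for j
    proof -
      have "\<bar>z j + int CARD('n)\<bar> \<le> int (M + CARD('n))" "\<bar>z j - int CARD('n)\<bar> \<le> int (M + CARD('n))"
        using zk(2)[OF that] by auto
      then show "z(j := z j + int CARD('n)) \<in> code_index M k" "z(j := z j - int CARD('n)) \<in> code_index M k"
        unfolding code_index_def using zk(1) order_trans[OF zk(2)] that by auto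
    qed
    ultimately show "affine_part M k (R f) z x = affine_part M k (grid_code M f) z x"
      "error_part M k (R f) z = error_part M k (grid_code M f) z"
      unfolding affine_part_def error_part_def R_def by auto
  qed
  then have shell: "cell_shell M k \<sigma> (R f) z = cell_shell M k \<sigma> (grid_code M f) z" if "z \<in> cell_index M k" for f z
    using that by (simp add: cell_shell_def)
  show ?thesis
  proof (intro exI[of _ \<F>] conjI)
    show "finite \<F>" by (rule card(1))
    show "card \<F> \<le> 2 ^ (code_exponent CARD('n) * M ^ (CARD('n) - 1))"
      using card(2) card_line_codes(2)[OF M i] by (rule order_trans)
    show "\<forall>(B, D)\<in>\<F>. D \<in> sets borel \<and> emeasure lborel D \<le> ennreal (shell_volume CARD('n) / (real M)\<^sup>2)"
    proof (unfold \<F>_def, clarsimp, intro conjI)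
      fix f assume f: "lip_convex k f"
      have D: "Df (R f) = (\<Union>z\<in>cell_index M k. cell_shell M k \<sigma> (grid_code M f) z)"
        unfolding Df_def using shell by simp
      show "Df (R f) \<in> sets borel" unfolding D
        using cell_shell_measure(1)[OF M \<sigma> error_part_nonneg[OF f M]] finite_cell_index
        by (intro sets.finite_UN) auto
      show "emeasure lborel (Df (R f)) \<le> ennreal (shell_volume CARD('n) / (real M)\<^sup>2)"
        unfolding D by (rule shell_measure[OF f M d \<sigma>])
    qed
    show "\<forall>f. lip_convex k f \<longrightarrow>
        (\<exists>(B, D)\<in>\<F>. \<forall>x. (\<forall>i. \<bar>x $ i\<bar> \<le> 1) \<longrightarrow> x \<notin> D \<longrightarrow> (f x \<le> \<sigma> * x $ k \<longleftrightarrow> x \<in> B))"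
    proof (intro allI impI)
      fix f assume f: "lip_convex k f"
      have "f x \<le> \<sigma> * x $ k \<longleftrightarrow> x \<in> Bf (R f)" if x: "\<forall>i. \<bar>x $ i\<bar> \<le> 1" and xD: "x \<notin> Df (R f)" for x
      proof -
        define z where "z j = (if j = k then 0 else \<lfloor>real M * x $ j\<rfloor>)" for j
        have "- int M \<le> \<lfloor>real M * x $ j\<rfloor>" "\<lfloor>real M * x $ j\<rfloor> \<le> int M" for j
        proof -
          have "\<bar>real M * x $ j\<bar> \<le> real M"
            using x mult_left_mono[of "\<bar>x $ j\<bar>" 1 "real M"] by (simp add: abs_mult)
          then show "- int M \<le> \<lfloor>real M * x $ j\<rfloor>" "\<lfloor>real M * x $ j\<rfloor> \<le> int M" by linarith+
        qed
        then have z: "z \<in> cell_index M k" by (auto simp: z_def cell_index_iff)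
        have xz: "x \<in> grid_cell M k z"
          unfolding grid_cell_def z_def by (auto intro: less_imp_le real_of_int_floor_add_one_gt)
        \<comment> \<open>Cells share faces, so the equivalence is shown for every cell containing
          \<open>x\<close>; the existential in \<open>Bf\<close> then cannot pick a wrong
          one.\<close>
        have *: "f x \<le> \<sigma> * x $ k \<longleftrightarrow> affine_part M k (R f) y x \<le> \<sigma> * x $ k"
          if y: "y \<in> cell_index M k" "x \<in> grid_cell M k y" for y
        proof -
          have "x \<notin> cell_shell M k \<sigma> (grid_code M f) y"
            using xD y(1) shell unfolding Df_def by auto
          then have "error_part M k (grid_code M f) y < \<bar>\<sigma> * x $ k - affine_part M k (grid_code M f) y x\<bar>"
            using y(2) unfolding cell_shell_def by auto
          then show ?thesis
            using affine_part_error[OF f M y(2)] unfolding R[OF y(1)] by linarith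
        qed
        show ?thesis unfolding Bf_def using * z xz by auto
      qed
      then show "\<exists>(B, D)\<in>\<F>. \<forall>x. (\<forall>i. \<bar>x $ i\<bar> \<le> 1) \<longrightarrow> x \<notin> D \<longrightarrow> (f x \<le> \<sigma> * x $ k \<longleftrightarrow> x \<in> B)"
        unfolding \<F>_def using f by (intro bexI[of _ "(Bf (R f), Df (R f))"]) auto
    qed
  qed
qed

section \<open>Brackets for convex sets\<close>

text \<open>The infimal convolution of the boundary of \<open>C\<close> facing direction
  \<open>k\<close> with the \<open>l1\<close> norm of the other coordinates. For nonempty compact
  \<open>C\<close> it is the largest function with that Lipschitz bound lying below
  \<open>\<sigma> * y $ k\<close> at each \<open>y \<in> C\<close>.\<close>

definition lip_envelope :: "'n::finite \<Rightarrow> real \<Rightarrow> (real^'n) set \<Rightarrow> real^'n \<Rightarrow> real" where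
  "lip_envelope k \<sigma> C x = (INF y\<in>C. \<sigma> * y $ k + (\<Sum>i\<in>UNIV - {k}. \<bar>x $ i - y $ i\<bar>))"

lemma lip_envelope_attained:
  fixes C :: "(real^'n) set"
  assumes "compact C" "C \<noteq> {}"
  obtains y where "y \<in> C" "lip_envelope k \<sigma> C x = \<sigma> * y $ k + (\<Sum>i\<in>UNIV - {k}. \<bar>x $ i - y $ i\<bar>)"
    and "\<And>y'. y' \<in> C \<Longrightarrow> lip_envelope k \<sigma> C x \<le> \<sigma> * y' $ k + (\<Sum>i\<in>UNIV - {k}. \<bar>x $ i - y' $ i\<bar>)"
proof -
  let ?h = "\<lambda>y. \<sigma> * y $ k + (\<Sum>i\<in>UNIV - {k}. \<bar>x $ i - y $ i\<bar>)"
  have "continuous_on C ?h" by (intro continuous_intros)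
  then obtain y where y: "y \<in> C" "\<forall>y'\<in>C. ?h y \<le> ?h y'"
    using continuous_attains_inf[OF assms, of ?h] by auto
  have "lip_envelope k \<sigma> C x = ?h y"
    unfolding lip_envelope_def by (rule cInf_eq_minimum) (use y in auto)
  then show ?thesis using that[of y] y by auto
qed

lemma lip_envelope_le:
  fixes C :: "(real^'n) set"
  assumes "compact C" "y \<in> C"
  shows "lip_envelope k \<sigma> C x \<le> \<sigma> * y $ k + (\<Sum>i\<in>UNIV - {k}. \<bar>x $ i - y $ i\<bar>)"
proof -
  have "C \<noteq> {}" using assms(2) by auto
  from lip_envelope_attained[OF assms(1) this, of k \<sigma> x] show ?thesis using assms(2) by blast
qed

text \<open>The minimised expression is jointly convex in \<open>x\<close> and \<open>y\<close>, and
  a convex combination of minimisers is again admissible because \<open>C\<close> is convex.\<close>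

lemma lip_convex_lip_envelope:
  fixes C :: "(real^'n) set"
  assumes C: "compact C" "C \<noteq> {}" "convex C" and cube: "\<And>x i. x \<in> C \<Longrightarrow> \<bar>x $ i\<bar> \<le> 1"
    and \<sigma>: "\<sigma> = 1 \<or> \<sigma> = -1"
  shows "lip_convex k (lip_envelope k \<sigma> C)"
  unfolding lip_convex_def
proof (intro conjI allI)
  let ?F = "lip_envelope k \<sigma> C"
  show "convex_on UNIV ?F"
  proof (rule convex_onI)
    fix t :: real and x1 x2 :: "real^'n" assume t: "0 < t" "t < 1"
    obtain y1 where y1: "y1 \<in> C" "?F x1 = \<sigma> * y1 $ k + (\<Sum>i\<in>UNIV - {k}. \<bar>x1 $ i - y1 $ i\<bar>)"
      using lip_envelope_attained[OF C(1,2)] by metis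
    obtain y2 where y2: "y2 \<in> C" "?F x2 = \<sigma> * y2 $ k + (\<Sum>i\<in>UNIV - {k}. \<bar>x2 $ i - y2 $ i\<bar>)"
      using lip_envelope_attained[OF C(1,2)] by metis
    let ?x = "(1 - t) *\<^sub>R x1 + t *\<^sub>R x2" and ?y = "(1 - t) *\<^sub>R y1 + t *\<^sub>R y2"
    have "?y \<in> C" using C(3) y1 y2 t by (intro convexD) auto
    then have "?F ?x \<le> \<sigma> * ?y $ k + (\<Sum>i\<in>UNIV - {k}. \<bar>?x $ i - ?y $ i\<bar>)"
      by (rule lip_envelope_le[OF C(1)])
    also have "(\<Sum>i\<in>UNIV - {k}. \<bar>?x $ i - ?y $ i\<bar>)
        \<le> (\<Sum>i\<in>UNIV - {k}. (1 - t) * \<bar>x1 $ i - y1 $ i\<bar> + t * \<bar>x2 $ i - y2 $ i\<bar>)"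
    proof (rule sum_mono)
      fix i
      have "?x $ i - ?y $ i = (1 - t) * (x1 $ i - y1 $ i) + t * (x2 $ i - y2 $ i)" by (simp add: algebra_simps)
      also have "\<bar>\<dots>\<bar> \<le> \<bar>(1 - t) * (x1 $ i - y1 $ i)\<bar> + \<bar>t * (x2 $ i - y2 $ i)\<bar>" by (rule abs_triangle_ineq)
      finally show "\<bar>?x $ i - ?y $ i\<bar> \<le> (1 - t) * \<bar>x1 $ i - y1 $ i\<bar> + t * \<bar>x2 $ i - y2 $ i\<bar>"
        using t by (simp add: abs_mult)
    qed
    also have "\<sigma> * ?y $ k + (\<Sum>i\<in>UNIV - {k}. (1 - t) * \<bar>x1 $ i - y1 $ i\<bar> + t * \<bar>x2 $ i - y2 $ i\<bar>)
      = (1 - t) * ?F x1 + t * ?F x2"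
      unfolding y1(2) y2(2) sum.distrib sum_distrib_left[symmetric] by (simp add: distrib_left ac_simps)
    finally show "?F ?x \<le> (1 - t) * ?F x1 + t * ?F x2" by simp
  qed auto
  show "?F x - ?F x' \<le> (\<Sum>i\<in>UNIV - {k}. \<bar>x $ i - x' $ i\<bar>)" for x x'
  proof -
    obtain y where y: "y \<in> C" "?F x' = \<sigma> * y $ k + (\<Sum>i\<in>UNIV - {k}. \<bar>x' $ i - y $ i\<bar>)"
      using lip_envelope_attained[OF C(1,2)] by metis
    have "?F x \<le> \<sigma> * y $ k + (\<Sum>i\<in>UNIV - {k}. \<bar>x $ i - y $ i\<bar>)"
      by (rule lip_envelope_le[OF C(1) y(1)])
    also have "(\<Sum>i\<in>UNIV - {k}. \<bar>x $ i - y $ i\<bar>) \<le> (\<Sum>i\<in>UNIV - {k}. \<bar>x $ i - x' $ i\<bar> + \<bar>x' $ i - y $ i\<bar>)"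
      by (intro sum_mono) linarith
    finally show ?thesis unfolding y(2) by (simp add: sum.distrib)
  qed
  show "\<bar>?F 0\<bar> \<le> real CARD('n)"
  proof -
    obtain y where y: "y \<in> C" "?F 0 = \<sigma> * y $ k + (\<Sum>i\<in>UNIV - {k}. \<bar>0 $ i - y $ i\<bar>)"
      using lip_envelope_attained[OF C(1,2)] by metis
    have "\<bar>?F 0\<bar> \<le> \<bar>\<sigma> * y $ k\<bar> + (\<Sum>i\<in>UNIV - {k}. \<bar>y $ i\<bar>)"
      unfolding y(2) by (rule order_trans[OF abs_triangle_ineq]) (simp add: sum_nonneg)
    also have "\<bar>\<sigma> * y $ k\<bar> = \<bar>y $ k\<bar>" using \<sigma> by auto
    also have "\<bar>y $ k\<bar> + (\<Sum>i\<in>UNIV - {k}. \<bar>y $ i\<bar>) = (\<Sum>i\<in>UNIV. \<bar>y $ i\<bar>)"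
      by (subst sum.remove[of UNIV k]) auto
    also have "\<dots> \<le> (\<Sum>i\<in>(UNIV::'n set). 1)" using cube[OF y(1)] by (intro sum_mono) auto
    finally show ?thesis by simp
  qed
qed

text \<open>A separating normal, scaled so that its largest coordinate is \<open>\<plusminus>1\<close>, separates within the
  envelope of that coordinate direction.\<close>

lemma mem_iff_lip_envelopes:
  fixes C :: "(real^'n) set"
  assumes C: "compact C" "C \<noteq> {}" "convex C"
  shows "x \<in> C \<longleftrightarrow> (\<forall>k. \<forall>\<sigma>\<in>{1, -1}. lip_envelope k \<sigma> C x \<le> \<sigma> * x $ k)"
proof
  assume x: "x \<in> C"
  show "\<forall>k. \<forall>\<sigma>\<in>{1, -1}. lip_envelope k \<sigma> C x \<le> \<sigma> * x $ k"
  proof (intro allI ballI)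
    fix k \<sigma>
    have "lip_envelope k \<sigma> C x \<le> \<sigma> * x $ k + (\<Sum>i\<in>UNIV - {k}. \<bar>x $ i - x $ i\<bar>)"
      by (rule lip_envelope_le[OF C(1) x])
    then show "lip_envelope k \<sigma> C x \<le> \<sigma> * x $ k" by simp
  qed
next
  assume le: "\<forall>k. \<forall>\<sigma>\<in>{1, -1}. lip_envelope k \<sigma> C x \<le> \<sigma> * x $ k"
  show "x \<in> C"
  proof (rule ccontr)
    assume "x \<notin> C"
    then obtain u b where ub: "u \<bullet> x < b" "\<forall>y\<in>C. u \<bullet> y > b"
      using separating_hyperplane_closed_point[OF C(3) compact_imp_closed[OF C(1)]] by blast
    then have less: "u \<bullet> x < u \<bullet> y" if "y \<in> C" for y using that by force
    have "Max (range (\<lambda>i. \<bar>u $ i\<bar>)) \<in> range (\<lambda>i. \<bar>u $ i\<bar>)" by (rule Max_in) auto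
    then obtain k where k: "Max (range (\<lambda>i. \<bar>u $ i\<bar>)) = \<bar>u $ k\<bar>" by (rule rangeE)
    have max: "\<bar>u $ i\<bar> \<le> \<bar>u $ k\<bar>" for i unfolding k[symmetric] by (rule Max_ge) auto
    have "u \<noteq> 0" using less C(2) by auto
    then obtain i where "u $ i \<noteq> 0" by (auto simp: vec_eq_iff)
    with max[of i] have uk: "u $ k \<noteq> 0" by auto
    define \<sigma> where "\<sigma> = sgn (u $ k)"
    have \<sigma>: "\<sigma> \<in> {1, -1}" "u $ k = \<bar>u $ k\<bar> * \<sigma>" using uk by (auto simp: \<sigma>_def sgn_if abs_if)
    obtain y where y: "y \<in> C" "lip_envelope k \<sigma> C x = \<sigma> * y $ k + (\<Sum>i\<in>UNIV - {k}. \<bar>x $ i - y $ i\<bar>)"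
      using lip_envelope_attained[OF C(1,2)] by metis
    have split: "u \<bullet> w = \<bar>u $ k\<bar> * (\<sigma> * w $ k) + (\<Sum>i\<in>UNIV - {k}. u $ i * w $ i)" for w
      unfolding inner_vec_def by (subst sum.remove[of _ k]) (simp_all add: mult.assoc[symmetric] \<sigma>(2)[symmetric])
    have "u \<bullet> y - u \<bullet> x = \<bar>u $ k\<bar> * (\<sigma> * y $ k) - \<bar>u $ k\<bar> * (\<sigma> * x $ k) + (\<Sum>i\<in>UNIV - {k}. u $ i * (y $ i - x $ i))"
      unfolding split by (simp add: algebra_simps sum_subtractf)
    \<comment> \<open>Since \<open>u $ k\<close> is the largest coordinate in modulus, all other
      slopes relative to it are at most 1, exactly what the \<open>l1\<close> term of the envelope
      absorbs.\<close>
    also have "(\<Sum>i\<in>UNIV - {k}. u $ i * (y $ i - x $ i)) \<le> (\<Sum>i\<in>UNIV - {k}. \<bar>u $ k\<bar> * \<bar>x $ i - y $ i\<bar>)"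
    proof (rule sum_mono)
      fix i
      have "u $ i * (y $ i - x $ i) \<le> \<bar>u $ i\<bar> * \<bar>x $ i - y $ i\<bar>"
        by (metis abs_ge_self abs_minus_commute abs_mult)
      also have "\<dots> \<le> \<bar>u $ k\<bar> * \<bar>x $ i - y $ i\<bar>" using max by (intro mult_right_mono) auto
      finally show "u $ i * (y $ i - x $ i) \<le> \<bar>u $ k\<bar> * \<bar>x $ i - y $ i\<bar>" .
    qed
    also have "\<bar>u $ k\<bar> * (\<sigma> * y $ k) - \<bar>u $ k\<bar> * (\<sigma> * x $ k) + (\<Sum>i\<in>UNIV - {k}. \<bar>u $ k\<bar> * \<bar>x $ i - y $ i\<bar>)
      = \<bar>u $ k\<bar> * (lip_envelope k \<sigma> C x - \<sigma> * x $ k)"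
      unfolding y(2) by (simp add: sum_distrib_left algebra_simps)
    also have "\<dots> \<le> 0" using le \<sigma>(1) by (intro mult_nonneg_nonpos) auto
    finally show False using less[OF y(1)] by simp
  qed
qed

text \<open>A bracket is chosen for each of the \<open>2 * d\<close> epigraphs; the approximations
  are intersected and the shells united. Numbers of choices multiply and shell volumes add.\<close>

lemma convex_brackets:
  assumes M: "M > 0" and d: "CARD('n::finite) \<ge> 2"
  obtains \<F> :: "((real^'n) set \<times> (real^'n) set) set"
  where "finite \<F>"
    and "card \<F> \<le> 1 + 2 ^ (2 * CARD('n) * (code_exponent CARD('n) * M ^ (CARD('n) - 1)))"
    and "\<forall>(B, D)\<in>\<F>. D \<in> sets borel \<and> emeasure lborel D \<le> ennreal (2 * real CARD('n) * (shell_volume CARD('n) / (real M)\<^sup>2))"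
    and "\<forall>C. compact C \<and> convex C \<and> (\<forall>x\<in>C. \<forall>i. \<bar>x $ i\<bar> \<le> 1) \<longrightarrow> (
      \<exists>(B, D)\<in>\<F>. \<forall>x. (\<forall>i. \<bar>x $ i\<bar> \<le> 1) \<longrightarrow> x \<notin> D \<longrightarrow> (x \<in> C \<longleftrightarrow> x \<in> B))"
proof -
  let ?E = "code_exponent CARD('n) * M ^ (CARD('n) - 1)" and ?v = "shell_volume CARD('n) / (real M)\<^sup>2"
  let ?I = "(UNIV::'n set) \<times> {1, -1::real}"
  have "\<forall>p\<in>?I. \<exists>\<F> :: ((real^'n) set \<times> (real^'n) set) set. finite \<F> \<and> card \<F> \<le> 2 ^ ?E
    \<and> (\<forall>(B, D)\<in>\<F>. D \<in> sets borel \<and> emeasure lborel D \<le> ennreal ?v)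
    \<and> (\<forall>f. lip_convex (fst p) f \<longrightarrow>
        (\<exists>(B, D)\<in>\<F>. \<forall>x. (\<forall>i. \<bar>x $ i\<bar> \<le> 1) \<longrightarrow> x \<notin> D \<longrightarrow> (f x \<le> snd p * x $ fst p \<longleftrightarrow> x \<in> B)))"
    using epigraph_brackets[OF M d] by force
  from bchoice[OF this] obtain \<G> where \<G>: "\<forall>p\<in>?I. finite (\<G> p) \<and> card (\<G> p) \<le> 2 ^ ?E
    \<and> (\<forall>(B, D)\<in>\<G> p. D \<in> sets borel \<and> emeasure lborel D \<le> ennreal ?v)
    \<and> (\<forall>f. lip_convex (fst p) f \<longrightarrow>
        (\<exists>(B, D)\<in>\<G> p. \<forall>x::real^'n. (\<forall>i. \<bar>x $ i\<bar> \<le> 1) \<longrightarrow> x \<notin> D \<longrightarrow> (f x \<le> snd p * x $ fst p \<longleftrightarrow> x \<in> B)))"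
    by (rule exE)
  have fin: "finite (\<G> p)" and card: "card (\<G> p) \<le> 2 ^ ?E" if "p \<in> ?I" for p
    using bspec[OF \<G> that] by auto
  have meas: "snd q \<in> sets borel" "emeasure lborel (snd q) \<le> ennreal ?v" if "p \<in> ?I" "q \<in> \<G> p" for p q
    using bspec[OF \<G> that(1)] that(2) by (auto simp: case_prod_beta)
  have br: "\<exists>q\<in>\<G> p. \<forall>x::real^'n. (\<forall>i. \<bar>x $ i\<bar> \<le> 1) \<longrightarrow> x \<notin> snd q \<longrightarrow> (f x \<le> snd p * x $ fst p \<longleftrightarrow> x \<in> fst q)"
    if "p \<in> ?I" "lip_convex (fst p) f" for p f
    using bspec[OF \<G> that(1)] that(2) by (simp add: case_prod_beta)
  define comb where "comb \<psi> = ((\<Inter>p\<in>?I. fst (\<psi> p)), (\<Union>p\<in>?I. snd (\<psi> p)))"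
    for \<psi> :: "'n \<times> real \<Rightarrow> (real^'n) set \<times> (real^'n) set"
  \<comment> \<open>The pair \<open>({}, {})\<close> brackets the empty set, to which the envelopes
    do not apply; it accounts for the \<open>1 +\<close> in the count.\<close>
  define \<F> where "\<F> = insert ({}, {}) (comb ` PiE ?I \<G>)"
  have finI: "finite ?I" by simp
  have cardI: "card ?I = 2 * CARD('n)" by (simp add: card_cartesian_product)
  have finP: "finite (PiE ?I \<G>)" by (intro finite_PiE finI fin)
  have v0: "0 \<le> ?v" by (simp add: shell_volume_def)
  show ?thesis
  proof (rule that[of \<F>])
    show "finite \<F>" unfolding \<F>_def using finP by simp
    have "card (PiE ?I \<G>) = (\<Prod>p\<in>?I. card (\<G> p))" by (rule card_PiE[OF finI])
    also have "\<dots> \<le> (\<Prod>p\<in>?I. 2 ^ ?E)" using card by (intro prod_mono) auto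
    also have "\<dots> = (2 ^ ?E) ^ (2 * CARD('n))" by (simp only: prod_constant cardI)
    also have "\<dots> = 2 ^ (2 * CARD('n) * ?E)" by (simp only: power_mult[symmetric] mult.commute)
    finally have "card (comb ` PiE ?I \<G>) \<le> 2 ^ (2 * CARD('n) * ?E)"
      using card_image_le[OF finP, of comb] by linarith
    then show "card \<F> \<le> 1 + 2 ^ (2 * CARD('n) * ?E)"
      unfolding \<F>_def using finP by (simp add: card_insert_if)
  next
    show "\<forall>(B, D)\<in>\<F>. D \<in> sets borel \<and> emeasure lborel D \<le> ennreal (2 * real CARD('n) * ?v)"
    proof clarify
      fix B D assume "(B, D) \<in> \<F>"
      then consider "D = {}" | \<psi> where "\<psi> \<in> PiE ?I \<G>" "D = (\<Union>p\<in>?I. snd (\<psi> p))"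
        unfolding \<F>_def comb_def by auto
      then show "D \<in> sets borel \<and> emeasure lborel D \<le> ennreal (2 * real CARD('n) * ?v)"
      proof cases
        case 2
        have m: "snd (\<psi> p) \<in> sets borel" "emeasure lborel (snd (\<psi> p)) \<le> ennreal ?v" if "p \<in> ?I" for p
          using meas[OF that PiE_mem[OF 2(1) that]] by auto
        have "emeasure lborel D \<le> (\<Sum>p\<in>?I. emeasure lborel (snd (\<psi> p)))"
          unfolding 2(2) using m(1) by (intro emeasure_subadditive_finite finI) auto
        also have "\<dots> \<le> (\<Sum>p\<in>?I. ennreal ?v)" using m(2) by (rule sum_mono)
        also have "\<dots> = ennreal (\<Sum>p\<in>?I. ?v)" using v0 by (intro sum_ennreal) auto
        also have "(\<Sum>p\<in>?I. ?v) = 2 * real CARD('n) * ?v" by (simp only: sum_constant cardI of_nat_mult of_nat_numeral)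
        finally show ?thesis unfolding 2(2) using m(1) by (auto intro!: sets.finite_UN finI)
      qed simp
    qed
  next
    show "\<forall>C. compact C \<and> convex C \<and> (\<forall>x\<in>C. \<forall>i. \<bar>x $ i\<bar> \<le> 1) \<longrightarrow>
      (\<exists>(B, D)\<in>\<F>. \<forall>x. (\<forall>i. \<bar>x $ i\<bar> \<le> 1) \<longrightarrow> x \<notin> D \<longrightarrow> (x \<in> C \<longleftrightarrow> x \<in> B))"
    proof (intro allI impI, elim conjE)
      fix C :: "(real^'n) set" assume C: "compact C" "convex C" "\<forall>x\<in>C. \<forall>i. \<bar>x $ i\<bar> \<le> 1"
      show "\<exists>(B, D)\<in>\<F>. \<forall>x. (\<forall>i. \<bar>x $ i\<bar> \<le> 1) \<longrightarrow> x \<notin> D \<longrightarrow> (x \<in> C \<longleftrightarrow> x \<in> B)"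
      proof (cases "C = {}")
        case True
        then show ?thesis unfolding \<F>_def by auto
      next
        case False
        let ?F = "\<lambda>p. lip_envelope (fst p) (snd p) C"
        have "lip_convex (fst p) (?F p)" if "p \<in> ?I" for p
          using that C False by (intro lip_convex_lip_envelope) auto
        then have "\<forall>p\<in>?I. \<exists>q. q \<in> \<G> p \<and> (\<forall>x::real^'n. (\<forall>i. \<bar>x $ i\<bar> \<le> 1) \<longrightarrow> x \<notin> snd q
            \<longrightarrow> (?F p x \<le> snd p * x $ fst p \<longleftrightarrow> x \<in> fst q))"
          using br by blast
        from bchoice[OF this] obtain \<psi> where \<psi>: "\<forall>p\<in>?I. \<psi> p \<in> \<G> p \<and> (\<forall>x::real^'n. (\<forall>i. \<bar>x $ i\<bar> \<le> 1) \<longrightarrow> x \<notin> snd (\<psi> p)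
            \<longrightarrow> (?F p x \<le> snd p * x $ fst p \<longleftrightarrow> x \<in> fst (\<psi> p)))" by (rule exE)
        have "comb (restrict \<psi> ?I) \<in> \<F>"
          unfolding \<F>_def using \<psi> by (intro insertI2 imageI restrict_PiE_iff[THEN iffD2]) auto
        moreover have "comb (restrict \<psi> ?I) = comb \<psi>" unfolding comb_def by simp
        moreover have "x \<in> C \<longleftrightarrow> x \<in> (\<Inter>p\<in>?I. fst (\<psi> p))"
          if x: "\<forall>i. \<bar>x $ i\<bar> \<le> 1" "x \<notin> (\<Union>p\<in>?I. snd (\<psi> p))" for x
        proof -
          have "x \<in> C \<longleftrightarrow> (\<forall>p\<in>?I. ?F p x \<le> snd p * x $ fst p)"
            unfolding mem_iff_lip_envelopes[OF C(1) False C(2)] by auto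
          also have "\<dots> \<longleftrightarrow> (\<forall>p\<in>?I. x \<in> fst (\<psi> p))"
          proof (rule ball_cong[OF refl])
            fix p assume p: "p \<in> ?I"
            then have "x \<notin> snd (\<psi> p)" using x(2) by blast
            then show "?F p x \<le> snd p * x $ fst p \<longleftrightarrow> x \<in> fst (\<psi> p)"
              using bspec[OF \<psi> p] x(1) by simp
          qed
          also have "\<dots> \<longleftrightarrow> x \<in> (\<Inter>p\<in>?I. fst (\<psi> p))" by (rule INT_iff[symmetric])
          finally show ?thesis .
        qed
        ultimately show ?thesis
          by (intro bexI[of _ "comb \<psi>"]) (auto simp: comb_def simp del: INT_iff UN_iff)
      qed
    qed
  qed
qed

section \<open>The two bounds\<close>

text \<open>The bracket is taken for the image of \<open>convex hull I\<close> under
  \<open>g\<close>. As the hull meets \<open>S\<close> in \<open>I\<close> only, the bracket decides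
  membership in \<open>I\<close> for every point of \<open>S\<close> mapped outside the
  shell.\<close>

lemma num_islands_le_brackets:
  fixes K :: "(real^'n) set"
  assumes K: "convex K" and S: "finite S" "S \<subseteq> K"
    and g: "continuous_on UNIV g" "\<And>C. convex C \<Longrightarrow> convex (g ` C)" "inj g"
      "\<And>x i. x \<in> K \<Longrightarrow> \<bar>g x $ i\<bar> \<le> 1"
    and "finite \<F>"
    and br: "\<forall>C. compact C \<and> convex C \<and> (\<forall>x\<in>C. \<forall>i. \<bar>x $ i\<bar> \<le> 1) \<longrightarrow>
      (\<exists>(B, D)\<in>\<F>. \<forall>x. (\<forall>i. \<bar>x $ i\<bar> \<le> 1) \<longrightarrow> x \<notin> D \<longrightarrow> (x \<in> C \<longleftrightarrow> x \<in> B))"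
  shows "num_islands S \<le> (\<Sum>(B, D)\<in>\<F>. 2 ^ card (S \<inter> g -` D))"
proof -
  define \<I> where "\<I> q = (\<lambda>J. (S \<inter> g -` (fst q - snd q)) \<union> J) ` Pow (S \<inter> g -` snd q)" for q
  have "{I. is_island S I} \<subseteq> (\<Union>q\<in>\<F>. \<I> q)"
  proof
    fix I assume "I \<in> {I. is_island S I}"
    then have I: "I \<subseteq> S" "convex hull I \<inter> S = I" by (auto simp: is_island_def)
    have "finite I" using I(1) S(1) by (rule finite_subset)
    have "convex hull I \<subseteq> K" using I(1) S(2) K by (intro hull_minimal) auto
    have "compact (g ` (convex hull I))"
      using \<open>finite I\<close> by (intro compact_continuous_image finite_imp_compact_convex_hull continuous_on_subset[OF g(1)]) auto
    moreover have "convex (g ` (convex hull I))" by (intro g(2)) simp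
    moreover have "\<forall>x\<in>g ` (convex hull I). \<forall>i. \<bar>x $ i\<bar> \<le> 1" using \<open>convex hull I \<subseteq> K\<close> g(4) by auto
    ultimately obtain q where q: "q \<in> \<F>"
      "\<forall>x. (\<forall>i. \<bar>x $ i\<bar> \<le> 1) \<longrightarrow> x \<notin> snd q \<longrightarrow> (x \<in> g ` (convex hull I) \<longleftrightarrow> x \<in> fst q)"
      using spec[OF br, of "g ` (convex hull I)"] by (auto simp: case_prod_beta)
    have mem: "x \<in> I \<longleftrightarrow> g x \<in> fst q" if "x \<in> S" "g x \<notin> snd q" for x
    proof -
      have "x \<in> I \<longleftrightarrow> x \<in> convex hull I" using I that(1) by blast
      also have "\<dots> \<longleftrightarrow> g x \<in> g ` (convex hull I)" using g(3) by (simp add: inj_image_mem_iff)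
      also have "\<dots> \<longleftrightarrow> g x \<in> fst q" using q(2) that S(2) g(4) by blast
      finally show ?thesis .
    qed
    have "I = (S \<inter> g -` (fst q - snd q)) \<union> (I \<inter> g -` snd q)" using I(1) mem by blast
    moreover have "I \<inter> g -` snd q \<in> Pow (S \<inter> g -` snd q)" using I(1) by blast
    ultimately have "I \<in> \<I> q" unfolding \<I>_def by (rule image_eqI)
    then show "I \<in> (\<Union>q\<in>\<F>. \<I> q)" using q(1) by blast
  qed
  moreover have fin: "finite (\<I> q)" for q unfolding \<I>_def using S(1) by simp
  ultimately have "num_islands S \<le> card (\<Union>q\<in>\<F>. \<I> q)"
    unfolding num_islands_def using \<open>finite \<F>\<close> by (intro card_mono) auto
  also have "\<dots> \<le> (\<Sum>q\<in>\<F>. card (\<I> q))" by (rule card_UN_le[OF \<open>finite \<F>\<close>])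
  also have "\<dots> \<le> (\<Sum>q\<in>\<F>. 2 ^ card (S \<inter> g -` snd q))"
  proof (rule sum_mono)
    fix q
    have "card (\<I> q) \<le> card (Pow (S \<inter> g -` snd q))" unfolding \<I>_def using S(1) by (intro card_image_le) simp
    then show "card (\<I> q) \<le> 2 ^ card (S \<inter> g -` snd q)" using S(1) by (simp only: card_Pow finite_Int simp_thms)
  qed
  finally show ?thesis by (simp add: case_prod_beta)
qed

text \<open>Only an inequality, since repeated sample points count once on the left and once per
  index on the right.\<close>

lemma power_card_le_prod:
  fixes n :: nat
  shows "2 ^ card (x ` {..<n} \<inter> D) \<le> (\<Prod>i<n. 1 + 1 * indicat_real D (x i))"
proof -
  have fin: "finite {i. i < n \<and> x i \<in> D}" by (rule finite_subset[of _ "{..<n}"]) auto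
  have "card (x ` {..<n} \<inter> D) \<le> card (x ` {i. i < n \<and> x i \<in> D})"
    by (rule card_mono[OF finite_imageI[OF fin]]) auto
  also have "\<dots> \<le> card {i. i < n \<and> x i \<in> D}" by (rule card_image_le[OF fin])
  finally have "(2::real) ^ card (x ` {..<n} \<inter> D) \<le> 2 ^ card {i. i < n \<and> x i \<in> D}"
    by (rule power_increasing) simp
  also have "\<dots> = (\<Prod>i<n. if x i \<in> D then 2 else 1)"
    by (simp add: prod.If_cases Int_def)
  also have "\<dots> = (\<Prod>i<n. 1 + 1 * indicat_real D (x i))" by (rule prod.cong) auto
  finally show ?thesis .
qed

text \<open>The brackets are fixed before sampling, so the expectation can be summed over them. The
  factor \<open>d ^ d\<close> is the upper bound for the scaling factor of the coordinates.\<close>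

lemma expected_islands_upper_grid:
  fixes K :: "(real^'n) set"
  assumes K: "convex_body K" "measure lborel K = 1" and M: "M > 0" and d: "CARD('n) \<ge> 2"
  shows "expected_islands n K
    \<le> (1 + 2 ^ (2 * CARD('n) * (code_exponent CARD('n) * M ^ (CARD('n) - 1))))
      * exp (real CARD('n) ^ CARD('n) * (2 * real CARD('n) * (shell_volume CARD('n) / (real M)\<^sup>2)) * real n)"
proof -
  let ?v = "2 * real CARD('n) * (shell_volume CARD('n) / (real M)\<^sup>2)"
  let ?p = "real CARD('n) ^ CARD('n) * ?v"
  obtain g :: "real^'n \<Rightarrow> real^'n" and c where g: "continuous_on UNIV g" "\<And>S. convex S \<Longrightarrow> convex (g ` S)"
    and em: "\<And>S. S \<in> sets borel \<Longrightarrow> emeasure lborel (g -` S) = ennreal c * emeasure lborel S"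
    and outer: "\<And>x i. x \<in> K \<Longrightarrow> \<bar>g x $ i\<bar> \<le> 1" and "inj g"
    and c: "c \<le> real CARD('n) ^ CARD('n)"
    by (rule convex_body_coordinates[OF K]) metis
  obtain \<F> :: "((real^'n) set \<times> (real^'n) set) set" where \<F>: "finite \<F>"
    "card \<F> \<le> 1 + 2 ^ (2 * CARD('n) * (code_exponent CARD('n) * M ^ (CARD('n) - 1)))"
    and meas: "\<forall>(B, D)\<in>\<F>. D \<in> sets borel \<and> emeasure lborel D \<le> ennreal ?v"
    and br: "\<forall>C. compact C \<and> convex C \<and> (\<forall>x\<in>C. \<forall>i. \<bar>x $ i\<bar> \<le> 1) \<longrightarrow>
      (\<exists>(B, D)\<in>\<F>. \<forall>x. (\<forall>i. \<bar>x $ i\<bar> \<le> 1) \<longrightarrow> x \<notin> D \<longrightarrow> (x \<in> C \<longleftrightarrow> x \<in> B))"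
    by (rule convex_brackets[OF M d])
  have borel: "snd q \<in> sets borel" and vol: "emeasure lborel (snd q) \<le> ennreal ?v" if "q \<in> \<F>" for q
    using bspec[OF meas that] by (simp_all add: case_prod_beta)
  have v0: "?v \<ge> 0" by (simp add: shell_volume_def)
  have gD: "g -` snd q \<in> sets borel" if "q \<in> \<F>" for q
    using measurable_sets_borel[OF borel_measurable_continuous_onI[OF g(1)] borel[OF that]] by simp
  have p: "measure lborel (K \<inter> g -` snd q) \<le> ?p" if q: "q \<in> \<F>" for q
  proof -
    have "bounded (K \<inter> g -` snd q)" using K(1) by (auto simp: convex_body_def compact_imp_bounded bounded_Int)
    then have "ennreal (measure lborel (K \<inter> g -` snd q)) = emeasure lborel (K \<inter> g -` snd q)"
      by (rule emeasure_lborel_bounded[symmetric])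
    also have "\<dots> \<le> emeasure lborel (g -` snd q)" using gD[OF q] by (intro emeasure_mono) auto
    also have "\<dots> = ennreal c * emeasure lborel (snd q)" by (rule em[OF borel[OF q]])
    also have "\<dots> \<le> ennreal (real CARD('n) ^ CARD('n)) * ennreal ?v"
      using vol[OF q] c by (intro mult_mono ennreal_leI) auto
    also have "\<dots> = ennreal ?p" by (rule ennreal_mult'[symmetric]) simp
    finally show ?thesis using mult_nonneg_nonneg[OF zero_le_power v0] by (subst (asm) ennreal_le_iff) auto
  qed
  let ?h = "\<lambda>x. \<Sum>q\<in>\<F>. \<Prod>i<n. 1 + 1 * indicat_real (g -` snd q) (x i)"
  \<comment> \<open>The sample space contains all families of points; they lie in \<open>K\<close>,
    where the brackets apply, only almost surely.\<close>
  have "AE x in uniform_sample n K. \<forall>i\<in>{..<n}. x i \<in> K"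
    unfolding uniform_sample_def using K(1)
    by (intro eventually_ball_finite ballI AE_PiM_component prob_space_uniform[OF K] AE_uniform_measureI)
      (auto simp: convex_body_def borel_compact)
  then have ae: "AE x in uniform_sample n K. real (num_islands (x ` {..<n})) \<le> ?h x"
  proof (rule AE_mp, intro AE_I2 impI)
    fix x assume x: "\<forall>i\<in>{..<n}. x i \<in> K"
    have "num_islands (x ` {..<n}) \<le> (\<Sum>(B, D)\<in>\<F>. 2 ^ card (x ` {..<n} \<inter> g -` D))"
      using K(1) x by (intro num_islands_le_brackets[OF _ _ _ g \<open>inj g\<close> outer \<F>(1) br]) (auto simp: convex_body_def)
    then have "real (num_islands (x ` {..<n})) \<le> real (\<Sum>(B, D)\<in>\<F>. 2 ^ card (x ` {..<n} \<inter> g -` D))"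
      by (rule of_nat_mono)
    also have "\<dots> = (\<Sum>q\<in>\<F>. 2 ^ card (x ` {..<n} \<inter> g -` snd q))" by (simp add: case_prod_beta)
    also have "\<dots> \<le> ?h x" by (intro sum_mono power_card_le_prod)
    finally show "real (num_islands (x ` {..<n})) \<le> ?h x" .
  qed
  have "expected_islands n K \<le> (LINT x | uniform_sample n K. ?h x)"
    unfolding expected_islands_def
    by (intro integral_mono_AE integrable_num_islands[OF K] ae Bochner_Integration.integrable_sum prod_sample(1)[OF K] gD)
  also have "\<dots> = (\<Sum>q\<in>\<F>. (1 + 1 * measure lborel (K \<inter> g -` snd q)) ^ n)"
    using prod_sample[OF K gD, where a = 1 and n = n]
    by (subst Bochner_Integration.integral_sum) auto
  also have "\<dots> \<le> (\<Sum>q\<in>\<F>. exp (?p * real n))"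
  proof (rule sum_mono)
    fix q assume q: "q \<in> \<F>"
    have "1 + 1 * measure lborel (K \<inter> g -` snd q) \<le> exp ?p"
      using p[OF q] exp_ge_add_one_self[of ?p] by linarith
    then have "(1 + 1 * measure lborel (K \<inter> g -` snd q)) ^ n \<le> exp ?p ^ n"
      by (rule power_mono) simp
    also have "\<dots> = exp (?p * real n)" by (rule exp_of_nat2_mult[symmetric])
    finally show "(1 + 1 * measure lborel (K \<inter> g -` snd q)) ^ n \<le> exp (?p * real n)" .
  qed
  also have "\<dots> = real (card \<F>) * exp (?p * real n)" by simp
  also have "\<dots> \<le> real (1 + 2 ^ (2 * CARD('n) * (code_exponent CARD('n) * M ^ (CARD('n) - 1)))) * exp (?p * real n)"
    by (intro mult_right_mono of_nat_mono \<F>(2)) simp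
  finally show ?thesis by simp
qed

theorem theorem4:
  assumes "CARD('n::finite) \<ge> 2"
  shows "\<exists>C1 C2 :: real. \<exists>n0 :: nat. C1 > 0 \<and> C2 > 0 \<and>
    (\<forall>K :: (real ^ 'n) set. convex_body K \<and> measure lborel K = 1 \<longrightarrow>
      (\<forall>n\<ge>n0.
        2 powr (C1 * real n powr ((real CARD('n) - 1) / (real CARD('n) + 1)))
          \<le> expected_islands n K \<and>
        expected_islands n K
          \<le> 2 powr (C2 * real n powr ((real CARD('n) - 1) / (real CARD('n) + 1)))))"
proof -
  let ?d = "CARD('n)"
  define \<alpha> where "\<alpha> = (real ?d - 1) / (real ?d + 1)"
  define b where "b = 1 / real ?d"
  \<comment> \<open>The divisor \<open>2 ^ (d + 1)\<close> pays for rounding \<open>t\<close> up to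
    the integer \<open>M\<close>, which is at most \<open>2 * t\<close>.\<close>
  define \<kappa> where "\<kappa> = (1 / 2) ^ ?d * (b\<^sup>2 / 16 * (b\<^sup>2 / 2) ^ (?d - 1)) / 2 ^ (?d + 1)"
  define E where "E = 2 * ?d * code_exponent ?d"
  define P where "P = real ?d ^ ?d * (2 * real ?d * shell_volume ?d)"
  define C1 where "C1 = 1 - exp (- \<kappa>)"
  \<comment> \<open>The summands belong to the \<open>1 +\<close> in the bracket count, to the
    number of brackets with \<open>M\<close> at most \<open>2 * t\<close>, and to the shell factor
    converted from base \<open>e\<close> to base 2.\<close>
  define C2 where "C2 = 1 + real E * 2 ^ (?d - 1) + P / ln 2"
  have d: "real ?d \<ge> 2" using assms by simp
  have \<kappa>: "\<kappa> > 0" using d by (simp add: \<kappa>_def b_def)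
  have P: "P \<ge> 0" by (simp add: P_def shell_volume_def)
  have "C1 > 0" using \<kappa> by (simp add: C1_def)
  moreover have "C2 > 0" using P unfolding C2_def by (intro add_pos_nonneg) auto
  moreover have "2 powr (C1 * real n powr \<alpha>) \<le> expected_islands n K \<and> expected_islands n K \<le> 2 powr (C2 * real n powr \<alpha>)"
    if K: "convex_body K" "measure lborel K = 1" and n: "n \<ge> 1" for K :: "(real^'n) set" and n
  proof -
    \<comment> \<open>The exponent for which \<open>t ^ (d - 1)\<close> and
      \<open>n / t\<^sup>2\<close> coincide, both being \<open>real n powr \<alpha>\<close>.\<close>
    define t where "t = real n powr (1 / (real ?d + 1))"
    define M where "M = nat \<lceil>t\<rceil>"
    have t1: "t \<ge> 1" unfolding t_def using n d by (intro ge_one_powr_ge_zero) auto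
    have Mt: "t \<le> real M" "real M \<le> 2 * t" and M0: "M > 0"
      unfolding M_def using t1 by linarith+
    have t_pow: "t ^ (?d + 1) = real n"
    proof -
      have "t ^ (?d + 1) = t powr real (?d + 1)" using t1 by (intro powr_realpow[symmetric]) simp
      also have "\<dots> = real n powr (1 / (real ?d + 1) * real (?d + 1))" unfolding t_def by (rule powr_powr)
      also have "1 / (real ?d + 1) * real (?d + 1) = 1" using d by simp
      finally show ?thesis using n by simp
    qed
    have t_alpha: "t ^ (?d - 1) = real n powr \<alpha>"
    proof -
      have "t ^ (?d - 1) = t powr real (?d - 1)" using t1 by (intro powr_realpow[symmetric]) simp
      also have "\<dots> = real n powr (1 / (real ?d + 1) * real (?d - 1))" unfolding t_def by (rule powr_powr)
      also have "1 / (real ?d + 1) * real (?d - 1) = \<alpha>" using assms by (simp add: \<alpha>_def of_nat_diff)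
      finally show ?thesis .
    qed
    have t_sq: "real n / t\<^sup>2 = real n powr \<alpha>"
    proof -
      have "?d + 1 = 2 + (?d - 1)" using assms by simp
      then have "real n = t\<^sup>2 * t ^ (?d - 1)" unfolding t_pow[symmetric] by (simp only: power_add)
      then show ?thesis using t1 t_alpha by simp
    qed
    \<comment> \<open>This absorbs additive constants in the exponent already for
      \<open>n \<ge> 1\<close>, so the threshold can be 1.\<close>
    have a1: "real n powr \<alpha> \<ge> 1" unfolding t_alpha[symmetric] using t1 by simp
    have lower: "2 powr (C1 * real n powr \<alpha>) \<le> expected_islands n K"
    proof -
      let ?q = "(1 / 2) ^ ?d * (b\<^sup>2 / 16 * (b\<^sup>2 / 2) ^ (?d - 1))"
      have "real M ^ (?d + 1) \<le> (2 * t) ^ (?d + 1)" using Mt by (intro power_mono) auto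
      also have "\<dots> = 2 ^ (?d + 1) * real n" unfolding power_mult_distrib t_pow ..
      finally have "?q / (2 ^ (?d + 1) * real n) \<le> ?q / real M ^ (?d + 1)"
        using M0 n by (intro divide_left_mono) (auto simp: b_def)
      then have "?q / (2 ^ (?d + 1) * real n) * real n \<le> ?q / real M ^ (?d + 1) * real n"
        by (rule mult_right_mono) simp
      then have k: "\<kappa> \<le> ?q / real M ^ (?d + 1) * real n" using n by (simp add: \<kappa>_def)
      have "C1 * real n powr \<alpha> = t ^ (?d - 1) * (1 - exp (- \<kappa>))" unfolding C1_def t_alpha by simp
      also have "\<dots> \<le> real M ^ (?d - 1) * (1 - exp (- (?q / real M ^ (?d + 1) * real n)))"
        using Mt t1 k \<kappa> by (intro mult_mono power_mono) auto
      finally have "2 powr (C1 * real n powr \<alpha>) \<le> 2 powr (real M ^ (?d - 1) * (1 - exp (- (?q / real M ^ (?d + 1) * real n))))"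
        by (rule powr_mono) simp
      also have "\<dots> \<le> expected_islands n K"
        by (rule expected_islands_lower_grid[OF K M0 b_def])
      finally show ?thesis .
    qed
    have upper: "expected_islands n K \<le> 2 powr (C2 * real n powr \<alpha>)"
    proof -
      let ?e = "2 * ?d * (code_exponent ?d * M ^ (?d - 1))"
      have "real M ^ (?d - 1) \<le> (2 * t) ^ (?d - 1)" using Mt by (intro power_mono) auto
      also have "\<dots> = 2 ^ (?d - 1) * real n powr \<alpha>" unfolding power_mult_distrib t_alpha ..
      finally have "real E * real M ^ (?d - 1) \<le> real E * (2 ^ (?d - 1) * real n powr \<alpha>)" by (rule mult_left_mono) simp
      then have e: "real ?e \<le> real E * 2 ^ (?d - 1) * real n powr \<alpha>" by (simp add: E_def mult.assoc)
      have "(1::real) + 2 ^ ?e \<le> 2 * 2 ^ ?e" using one_le_power[of "2::real" ?e] by simp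
      also have "\<dots> = 2 powr (1 + real ?e)" by (simp only: powr_add powr_one powr_realpow zero_less_numeral)
      also have "\<dots> \<le> 2 powr ((1 + real E * 2 ^ (?d - 1)) * real n powr \<alpha>)"
        using e a1 by (intro powr_mono) (auto simp: distrib_right)
      finally have 1: "(1::real) + 2 ^ ?e \<le> 2 powr ((1 + real E * 2 ^ (?d - 1)) * real n powr \<alpha>)" .
      have "real n / (real M)\<^sup>2 \<le> real n / t\<^sup>2"
        using Mt t1 M0 by (intro divide_left_mono power_mono mult_pos_pos) auto
      then have "P * (real n / (real M)\<^sup>2) \<le> P * real n powr \<alpha>" unfolding t_sq using P by (rule mult_left_mono)
      moreover have "real ?d ^ ?d * (2 * real ?d * (shell_volume ?d / (real M)\<^sup>2)) * real n = P * (real n / (real M)\<^sup>2)"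
        by (simp add: P_def)
      ultimately have "exp (real ?d ^ ?d * (2 * real ?d * (shell_volume ?d / (real M)\<^sup>2)) * real n) \<le> exp (P * real n powr \<alpha>)"
        by (simp only: exp_le_cancel_iff)
      also have "\<dots> = 2 powr (P / ln 2 * real n powr \<alpha>)" by (simp add: powr_def)
      finally have 2: "exp (real ?d ^ ?d * (2 * real ?d * (shell_volume ?d / (real M)\<^sup>2)) * real n) \<le> 2 powr (P / ln 2 * real n powr \<alpha>)" .
      have "expected_islands n K \<le> 2 powr ((1 + real E * 2 ^ (?d - 1)) * real n powr \<alpha>) * 2 powr (P / ln 2 * real n powr \<alpha>)"
        by (rule order_trans[OF expected_islands_upper_grid[OF K M0 assms] mult_mono[OF 1 2]]) auto
      also have "\<dots> = 2 powr (C2 * real n powr \<alpha>)" unfolding C2_def by (simp add: powr_add[symmetric] distrib_right)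
      finally show ?thesis .
    qed
    from lower upper show ?thesis by blast
  qed
  ultimately show ?thesis unfolding \<alpha>_def by (intro exI[of _ C1] exI[of _ C2] exI[of _ 1]) auto
qed

end
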